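(* For every $a\in A=R(T)$, the multiplication operator $M_a:H\to H$, $M_ax=ax$, satisfies $$|M_a|_{\rm ord}=|M_a|_*=M_{|a|}.$$
   Context: Setting. All spaces are real. $E$ is a Dedekind complete Riesz space with weak order unit $e$. $T:E\to E$ is a conditional expectation operator, i.e. a positive order-continuous linear projection whose range is a Dedekind complete Riesz subspace and which maps weak order units to weak order units; it satisfies $Te=e$ and is strictly positive ($x\ge 0$ and $Tx=0$ imply $x=0$). $E^u$ is the universal completion of $E$, with its $f$-algebra multiplication having unit $e$. $L^1(T)\subseteq E^u$ is the natural domain of $T$: the set of differences $f_1-f_2$ with $f_i\in E^u_+$ such that there is a net $(f_\alpha)$ in $E_+$ with $f_\alpha\uparrow f_i$ in $E^u$ and $(Tf_\alpha)$ bounded above in $E^u$; $T$ is extended to $L^1(T)$ by $Tf_i=\sup_\alpha Tf_\alpha$, and the extension, still denoted $T$, is again a strictly positive conditional expectation on $L^1(T)$ with $Te=e$. $A:=R(T)$ is the range of the (extended) $T$; it is a Dedekind complete unital Archimedean $f$-algebra with unit $e$, and $T(az)=aT(z)$ for $a\in A$ whenever the products are defined. $H:=L^2(T)=\{x\in L^1(T):x^2\in L^1(T)\}$ with the inherited order is a Dedekind complete Riesz space and an $A$-module. For $x,y\in H$, $\langle x,y\rangle_T:=T(xy)\in A$ and $\|x\|_{T,2}:=(T(x^2))^{1/2}\in A_+$ (the positive square root in $A$). Definitions. $\mathcal B_T(H)$ is the set of $A$-linear (additive and $A$-homogeneous) maps $S:H\to H$ that are $T$-strongly bounded: there is $k\in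 A_+$ with $\|Sx\|_{T,2}\le k\|x\|_{T,2}$ for all $x\in H$. For $S\in\mathcal B_T(H)$, the adjoint $S^*$ is the unique operator in $\mathcal B_T(H)$ with $\langle Sx,y\rangle_T=\langle x,S^*y\rangle_T$ for all $x,y\in H$ (it always exists). $S$ is self-adjoint if $S^*=S$ and inner-product positive if $\langle Sx,x\rangle_T\ge0$ for all $x\in H$. For an order-bounded operator $S$ on $H$, $|S|_{\rm ord}$ is the Riesz--Kantorovich modulus, $|S|_{\rm ord}x=\sup\{|Su|:|u|\le x\}$ for $x\in H_+$. The spectral modulus $|S|_*:=(S^*S)^{1/2}$ of $S\in\mathcal B_T(H)$ is the unique self-adjoint inner-product positive $Q\in\mathcal B_T(H)$ with $Q^2=S^*S$ (it always exists). Each $M_a$ is an order-bounded element of $\mathcal B_T(H)$; $|a|$ is the modulus of $a$ in the Riesz space $A$. *)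

theory Defs
  imports Complex_Main "HOL-Library.FuncSet" "HOL-Library.Lattice_Algebras" "HOL-Library.Lub_Glb"
begin

section \<open>Riesz spaces, universal completeness and f-algebras\<close>

class riesz_space = ordered_real_vector + lattice_ab_group_add_abs

text \<open>Universally complete = Dedekind complete and laterally complete (every set of pairwise
  disjoint positive elements has a supremum).  Dedekind completeness is the library class
  \<^class>\<open>conditionally_complete_lattice\<close>; once \<open>D\<close> is bounded above, that class provides its
  supremum.\<close>

class universally_complete_riesz_space = riesz_space + conditionally_complete_lattice +
  assumes laterally_complete:
    "\<lbrakk>\<And>x. x \<in> D \<Longrightarrow> 0 \<le> x; \<And>x y. \<lbrakk>x \<in> D; y \<in> D; x \<noteq> y\<rbrakk> \<Longrightarrow> inf x y = 0\<rbrakk> \<Longrightarrow> bdd_above D"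

text \<open>Commutativity is not assumed: it is automatic in the Archimedean case.\<close>

class f_algebra = riesz_space + real_algebra + lattice_ring +
  assumes f_mult_left: "\<lbrakk>inf x y = 0; 0 \<le> z\<rbrakk> \<Longrightarrow> inf (z * x) y = 0"
    and f_mult_right: "\<lbrakk>inf x y = 0; 0 \<le> z\<rbrakk> \<Longrightarrow> inf (x * z) y = 0"

class universally_complete_f_algebra = universally_complete_riesz_space + f_algebra

section \<open>Riesz subspaces and their order properties\<close>

text \<open>Order notions for a subspace \<open>V\<close> are relative to \<open>V\<close>: \<^term>\<open>isLub V D s\<close> says that \<open>s\<close> is
  the supremum of \<open>D\<close> computed in \<open>V\<close>.\<close>

definition riesz_subspace :: "'u::riesz_space set \<Rightarrow> bool" where
  "riesz_subspace V \<longleftrightarrow> subspace V \<and> (\<forall>x\<in>V. \<forall>y\<in>V. sup x y \<in> V \<and> inf x y \<in> V)"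

definition dedekind_complete_on :: "'u::riesz_space set \<Rightarrow> bool" where
  "dedekind_complete_on V \<longleftrightarrow>
     (\<forall>D\<subseteq>V. D \<noteq> {} \<and> (\<exists>b. isUb V D b) \<longrightarrow> (\<exists>s. isLub V D s))"

definition order_dense :: "'u::riesz_space set \<Rightarrow> bool" where
  "order_dense V \<longleftrightarrow> (\<forall>u>0. \<exists>x\<in>V. 0 < x \<and> x \<le> u)"

definition weak_order_unit_on :: "'u::riesz_space set \<Rightarrow> 'u \<Rightarrow> bool" where
  "weak_order_unit_on V w \<longleftrightarrow> w \<in> V \<and> 0 \<le> w \<and> (\<forall>x\<in>V. inf w \<bar>x\<bar> = 0 \<longrightarrow> x = 0)"

text \<open>The universal completion of a Dedekind complete Riesz space \<open>E\<close> is a universally complete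
  Riesz space in which \<open>E\<close> is an order dense Riesz subspace; it is unique up to a Riesz
  isomorphism fixing \<open>E\<close>.  Here it is the whole type \<open>'u\<close>.\<close>

definition universal_completion_of :: "'u::universally_complete_riesz_space set \<Rightarrow> bool" where
  "universal_completion_of E \<longleftrightarrow> riesz_subspace E \<and> order_dense E"

section \<open>Conditional expectation operators\<close>

text \<open>Monotone nets enter only through their ranges, so they are represented by nonempty
  directed sets (a directed set being a monotone net indexed by itself).\<close>

definition up_directed :: "'u::order set \<Rightarrow> bool" where
  "up_directed D \<longleftrightarrow> D \<noteq> {} \<and> (\<forall>x\<in>D. \<forall>y\<in>D. \<exists>z\<in>D. x \<le> z \<and> y \<le> z)"

definition down_directed :: "'u::order set \<Rightarrow> bool" where
  "down_directed D \<longleftrightarrow> D \<noteq> {} \<and> (\<forall>x\<in>D. \<forall>y\<in>D. \<exists>z\<in>D. z \<le> x \<and> z \<le> y)"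

definition linear_operator_on :: "'u::real_vector set \<Rightarrow> ('u \<Rightarrow> 'u) \<Rightarrow> bool" where
  "linear_operator_on V T \<longleftrightarrow> T \<in> V \<rightarrow> V \<and>
     (\<forall>x\<in>V. \<forall>y\<in>V. T (x + y) = T x + T y) \<and> (\<forall>c. \<forall>x\<in>V. T (c *\<^sub>R x) = c *\<^sub>R T x)"

definition positive_on :: "'u::riesz_space set \<Rightarrow> ('u \<Rightarrow> 'u) \<Rightarrow> bool" where
  "positive_on V T \<longleftrightarrow> (\<forall>x\<in>V. 0 \<le> x \<longrightarrow> 0 \<le> T x)"

text \<open>Order continuity of a positive operator: \<open>x\<^sub>\<alpha> \<down> 0\<close> implies \<open>T x\<^sub>\<alpha> \<down> 0\<close>.\<close>

definition order_continuous_on :: "'u::riesz_space set \<Rightarrow> ('u \<Rightarrow> 'u) \<Rightarrow> bool" where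
  "order_continuous_on V T \<longleftrightarrow>
     (\<forall>D\<subseteq>V. down_directed D \<and> isGlb V D 0 \<longrightarrow> isGlb V (T ` D) 0)"

definition conditional_expectation_on :: "'u::riesz_space set \<Rightarrow> ('u \<Rightarrow> 'u) \<Rightarrow> bool" where
  "conditional_expectation_on V T \<longleftrightarrow>
     linear_operator_on V T \<and> positive_on V T \<and> order_continuous_on V T \<and>
     (\<forall>x\<in>V. T (T x) = T x) \<and>
     riesz_subspace (T ` V) \<and> dedekind_complete_on (T ` V) \<and>
     (\<forall>w. weak_order_unit_on V w \<longrightarrow> weak_order_unit_on V (T w))"

definition strictly_positive_on :: "'u::riesz_space set \<Rightarrow> ('u \<Rightarrow> 'u) \<Rightarrow> bool" where
  "strictly_positive_on V T \<longleftrightarrow> (\<forall>x\<in>V. 0 \<le> x \<and> T x = 0 \<longrightarrow> x = 0)"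

section \<open>The natural domain and the extended operator\<close>

text \<open>\<open>f\<^sub>\<alpha> \<up> f\<close> in the universal completion, with all \<open>f\<^sub>\<alpha>\<close> in the positive cone of \<open>E\<close>.\<close>

definition increases_to :: "'u::riesz_space set \<Rightarrow> 'u set \<Rightarrow> 'u \<Rightarrow> bool" where
  "increases_to E D f \<longleftrightarrow> D \<subseteq> {x\<in>E. 0 \<le> x} \<and> up_directed D \<and> isLub UNIV D f"

definition natural_domain_pos :: "'u::riesz_space set \<Rightarrow> ('u \<Rightarrow> 'u) \<Rightarrow> 'u set" where
  "natural_domain_pos E T = {f. 0 \<le> f \<and> (\<exists>D. increases_to E D f \<and> bdd_above (T ` D))}"

definition L1 :: "'u::riesz_space set \<Rightarrow> ('u \<Rightarrow> 'u) \<Rightarrow> 'u set" where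
  "L1 E T = {f1 - f2 | f1 f2. f1 \<in> natural_domain_pos E T \<and> f2 \<in> natural_domain_pos E T}"

definition extends_pos :: "'u::riesz_space set \<Rightarrow> ('u \<Rightarrow> 'u) \<Rightarrow> 'u \<Rightarrow> 'u \<Rightarrow> bool" where
  "extends_pos E T f s \<longleftrightarrow> (\<exists>D. increases_to E D f \<and> isLub UNIV (T ` D) s)"

text \<open>The value of the extended operator at \<open>f = f1 - f2\<close> is \<open>s1 - s2\<close>, whichever
  representation and whichever approximating nets are used.\<close>

definition extT :: "'u::riesz_space set \<Rightarrow> ('u \<Rightarrow> 'u) \<Rightarrow> 'u \<Rightarrow> 'u" where
  "extT E T f = (THE t. \<exists>f1 f2 s1 s2.
     f1 \<in> natural_domain_pos E T \<and> f2 \<in> natural_domain_pos E T \<and> f = f1 - f2 \<and>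
     extends_pos E T f1 s1 \<and> extends_pos E T f2 s2 \<and> t = s1 - s2)"

definition rangeT :: "'u::riesz_space set \<Rightarrow> ('u \<Rightarrow> 'u) \<Rightarrow> 'u set" where
  "rangeT E T = extT E T ` L1 E T"

section \<open>The module L2(T) and its operators\<close>

definition L2 :: "'u::f_algebra set \<Rightarrow> ('u \<Rightarrow> 'u) \<Rightarrow> 'u set" where
  "L2 E T = {x \<in> L1 E T. x * x \<in> L1 E T}"

definition inner_T :: "'u::f_algebra set \<Rightarrow> ('u \<Rightarrow> 'u) \<Rightarrow> 'u \<Rightarrow> 'u \<Rightarrow> 'u" where
  "inner_T E T x y = extT E T (x * y)"

definition norm_T2 :: "'u::f_algebra set \<Rightarrow> ('u \<Rightarrow> 'u) \<Rightarrow> 'u \<Rightarrow> 'u" where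
  "norm_T2 E T x = (THE r. r \<in> rangeT E T \<and> 0 \<le> r \<and> r * r = extT E T (x * x))"

text \<open>Operators on \<open>H = L2 E T\<close> are extensional functions (undefined outside \<open>H\<close>), so that
  equality of operators is equality of functions.\<close>

definition bounded_ops :: "'u::f_algebra set \<Rightarrow> ('u \<Rightarrow> 'u) \<Rightarrow> ('u \<Rightarrow> 'u) set" where
  "bounded_ops E T = {S \<in> L2 E T \<rightarrow>\<^sub>E L2 E T.
     (\<forall>x\<in>L2 E T. \<forall>y\<in>L2 E T. S (x + y) = S x + S y) \<and>
     (\<forall>a\<in>rangeT E T. \<forall>x\<in>L2 E T. S (a * x) = a * S x) \<and>
     (\<exists>k\<in>rangeT E T. 0 \<le> k \<and> (\<forall>x\<in>L2 E T. norm_T2 E T (S x) \<le> k * norm_T2 E T x))}"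

definition is_adjoint ::
  "'u::f_algebra set \<Rightarrow> ('u \<Rightarrow> 'u) \<Rightarrow> ('u \<Rightarrow> 'u) \<Rightarrow> ('u \<Rightarrow> 'u) \<Rightarrow> bool" where
  "is_adjoint E T S S' \<longleftrightarrow> S' \<in> bounded_ops E T \<and>
     (\<forall>x\<in>L2 E T. \<forall>y\<in>L2 E T. inner_T E T (S x) y = inner_T E T x (S' y))"

definition adjoint_T :: "'u::f_algebra set \<Rightarrow> ('u \<Rightarrow> 'u) \<Rightarrow> ('u \<Rightarrow> 'u) \<Rightarrow> 'u \<Rightarrow> 'u" where
  "adjoint_T E T S = (THE S'. is_adjoint E T S S')"

text \<open>\<open>S\<^sup>* = S\<close>, unfolded: \<open>S\<close> itself satisfies the property that singles out \<open>S\<^sup>*\<close>.\<close>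

definition self_adjoint :: "'u::f_algebra set \<Rightarrow> ('u \<Rightarrow> 'u) \<Rightarrow> ('u \<Rightarrow> 'u) \<Rightarrow> bool" where
  "self_adjoint E T S \<longleftrightarrow> S \<in> bounded_ops E T \<and> is_adjoint E T S S"

definition inner_positive :: "'u::f_algebra set \<Rightarrow> ('u \<Rightarrow> 'u) \<Rightarrow> ('u \<Rightarrow> 'u) \<Rightarrow> bool" where
  "inner_positive E T S \<longleftrightarrow> (\<forall>x\<in>L2 E T. 0 \<le> inner_T E T (S x) x)"

definition spectral_modulus ::
  "'u::f_algebra set \<Rightarrow> ('u \<Rightarrow> 'u) \<Rightarrow> ('u \<Rightarrow> 'u) \<Rightarrow> 'u \<Rightarrow> 'u" where
  "spectral_modulus E T S = (THE Q. Q \<in> bounded_ops E T \<and>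
     self_adjoint E T Q \<and> inner_positive E T Q \<and>
     compose (L2 E T) Q Q = compose (L2 E T) (adjoint_T E T S) S)"

text \<open>The Riesz--Kantorovich formula defines the modulus on the positive cone of \<open>H\<close>; it is
  extended by linearity through \<open>x = x\<^sup>+ - x\<^sup>-\<close>, where \<open>x\<^sup>+ = pprt x\<close> and \<open>x\<^sup>- = - nprt x\<close>.\<close>

definition rk_modulus :: "'u::riesz_space set \<Rightarrow> ('u \<Rightarrow> 'u) \<Rightarrow> 'u \<Rightarrow> 'u" where
  "rk_modulus H S x = (THE s. isLub H {\<bar>S u\<bar> | u. u \<in> H \<and> \<bar>u\<bar> \<le> x} s)"

definition order_modulus :: "'u::riesz_space set \<Rightarrow> ('u \<Rightarrow> 'u) \<Rightarrow> 'u \<Rightarrow> 'u" where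
  "order_modulus H S = (\<lambda>x\<in>H. rk_modulus H S (pprt x) - rk_modulus H S (- nprt x))"

definition mult_op :: "'u::f_algebra set \<Rightarrow> 'u \<Rightarrow> 'u \<Rightarrow> 'u" where
  "mult_op H a = (\<lambda>x\<in>H. a * x)"

end

theory Submission
  imports Defs
begin

text \<open>The operator \<open>M\<^bsub>|a|\<^esub>\<close> is self-adjoint, inner-product positive and squares to
  \<open>M\<^sub>a\<^sup>* M\<^sub>a = M\<^sub>a\<^sub>a\<close>, and \<open>|a| x\<close> is the maximum of \<open>|a u|\<close> over \<open>|u| \<le> x\<close>; what is left is the
  uniqueness of the positive square root, which needs no spectral theory because operators on \<open>L2(T)\<close>
  commute with \<open>M\<^bsub>|a|\<^esub>\<close>.  The facts about \<open>T\<close> that the informal statement takes for granted come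
  from approximation: every element of \<open>[0, x]\<close> is, up to \<open>x/n\<close>, a combination of components of
  \<open>x\<close>, for which commutativity of the product and \<open>T(a z) = a T z\<close> are questions of disjointness,
  and monotone convergence extends the averaging identity to unbounded \<open>a\<close>.\<close>

section \<open>Archimedean Riesz spaces\<close>

text \<open>The approximation arguments share one ending: every natural multiple of a difference
  stays below a fixed element, so the difference is at most 0. This turns errors of relative size
  1/n into exact identities without representing the space by functions. A second constraint is that
  \<open>extT\<close>, \<open>norm_T2\<close>, \<open>adjoint_T\<close> and
  \<open>spectral_modulus\<close> are definite descriptions: they have no properties until existence
  and uniqueness are known. For \<open>extT\<close> this means independence of the chosen nets,
  which is why the extension is studied first on the positive cone; for \<open>norm_T2\<close> it
  means constructing square roots inside \<open>A\<close>, so \<open>A\<close> must be closed under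
  products and directed suprema.\<close>

lemma isLub_UNIV_iff:
  "isLub UNIV D s \<longleftrightarrow> (\<forall>x\<in>D. x \<le> s) \<and> (\<forall>b. (\<forall>x\<in>D. x \<le> b) \<longrightarrow> s \<le> b)"
  by (auto simp: isLub_def leastP_def isUb_def setle_def setge_def)

lemma isLub_UNIV_unique:
  fixes s t :: "'a::order"
  shows "isLub UNIV D s \<Longrightarrow> isLub UNIV D t \<Longrightarrow> s = t"
  by (simp add: isLub_UNIV_iff order.antisym)

lemma isLub_Sup:
  fixes D :: "'a::conditionally_complete_lattice set"
  assumes "D \<noteq> {}" "bdd_above D"
  shows "isLub UNIV D (Sup D)"
  using assms by (auto simp: isLub_UNIV_iff intro: cSup_upper cSup_least)

text \<open>Adding \<open>x\<close> maps the set of multiples of \<open>x\<close> into itself, so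
  its supremum \<open>s\<close> satisfies \<open>s \<le> s - x\<close>.\<close>

lemma archimedean_nonpos:
  fixes x y :: "'a::{riesz_space,conditionally_complete_lattice}"
  assumes "\<And>n::nat. real n *\<^sub>R x \<le> y"
  shows "x \<le> 0"
proof -
  define S where "S = range (\<lambda>n. real n *\<^sub>R x)"
  have "bdd_above S" unfolding S_def using assms by (auto intro!: bdd_aboveI[of _ y])
  then have lub: "isLub UNIV S (Sup S)" unfolding S_def by (intro isLub_Sup) auto
  have "real n *\<^sub>R x \<le> Sup S - x" for n
  proof -
    have "real (Suc n) *\<^sub>R x \<in> S" unfolding S_def by blast
    then have "real (Suc n) *\<^sub>R x \<le> Sup S" using lub by (simp only: isLub_UNIV_iff)
    then show ?thesis by (simp add: algebra_simps)
  qed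
  then have "Sup S \<le> Sup S - x" using lub unfolding isLub_UNIV_iff S_def by blast
  then show ?thesis by simp
qed

lemma archimedean_eqI:
  fixes x y z :: "'a::{riesz_space,conditionally_complete_lattice}"
  assumes "\<And>n::nat. real n *\<^sub>R (x - y) \<le> z" "\<And>n::nat. real n *\<^sub>R (y - x) \<le> z"
  shows "x = y"
  using archimedean_nonpos[OF assms(1)] archimedean_nonpos[OF assms(2)] by simp

lemma diff_inf_eq_pprt: "g - inf g d = pprt (g - d)" for g :: "'a::lattice_ab_group_add"
  by (simp add: pprt_def add_sup_distrib_left sup_commute)

text \<open>Since \<open>g - inf g d\<close> is the positive part of \<open>g - d\<close>, it is at
  most \<open>f - d\<close>; a bound \<open>b\<close> for all \<open>inf g d\<close> thus yields the
  bound \<open>b - g + f\<close> for all \<open>d\<close>.\<close>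

lemma isLub_inf_left:
  fixes f g :: "'a::riesz_space"
  assumes "isLub UNIV D f" "g \<le> f"
  shows "isLub UNIV (inf g ` D) g"
proof -
  have "g \<le> b" if b: "\<And>d. d \<in> D \<Longrightarrow> inf g d \<le> b" for b
  proof -
    have "d \<le> b - g + f" if "d \<in> D" for d
    proof -
      have "d \<le> f" using assms(1) that by (simp add: isLub_UNIV_iff)
      then have "g - inf g d \<le> f - d"
        using assms(2) unfolding diff_inf_eq_pprt pprt_def by (simp add: diff_right_mono)
      then have "d \<le> inf g d - g + f" by (simp only: algebra_simps)
      also have "\<dots> \<le> b - g + f" using b[OF that] by (simp add: diff_right_mono)
      finally show ?thesis .
    qed
    then have "f \<le> b - g + f" using assms(1) unfolding isLub_UNIV_iff by blast
    then show ?thesis by simp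
  qed
  then show ?thesis by (auto simp: isLub_UNIV_iff)
qed

lemma up_directed_inf_left: "up_directed D \<Longrightarrow> up_directed (inf g ` D)"
  for g :: "'a::lattice"
  unfolding up_directed_def by (blast intro: inf_mono order_refl)

lemma up_directed_mono_seq:
  fixes f :: "nat \<Rightarrow> 'a::order"
  assumes "\<And>m n. m \<le> n \<Longrightarrow> f m \<le> f n"
  shows "up_directed (range f)"
  unfolding up_directed_def by (auto intro: assms) (meson assms max.cobounded1 max.cobounded2)

lemma up_directed_image_mono:
  assumes "up_directed D" "\<And>x y. x \<in> D \<Longrightarrow> y \<in> D \<Longrightarrow> x \<le> y \<Longrightarrow> f x \<le> f y"
  shows "up_directed (f ` D)"
  using assms unfolding up_directed_def by (simp add: image_iff) meson

lemma isLub_translate: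
  fixes s :: "'a::ordered_ab_group_add"
  assumes "isLub UNIV D s" shows "isLub UNIV ((\<lambda>x. x - t) ` D) (s - t)"
  using assms by (auto simp: isLub_UNIV_iff algebra_simps)

section \<open>Disjoint elements and components\<close>

lemma inf_eq_0_mono:
  fixes a b :: "'a::lattice_ab_group_add"
  assumes "inf a b = 0" "0 \<le> c" "c \<le> a" "0 \<le> d" "d \<le> b"
  shows "inf c d = 0"
  by (metis assms inf_mono le_inf_iff order.antisym)

lemma inf_add_eq_0:
  fixes a b c :: "'a::lattice_ab_group_add"
  assumes "inf a c = 0" "inf b c = 0"
  shows "inf (a + b) c = 0"
proof -
  have pos: "0 \<le> a" "0 \<le> b" "0 \<le> c" using assms by (metis inf.cobounded1 inf.cobounded2)+
  have "inf (a + b) c - a \<le> inf b c"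
  proof (rule inf_greatest)
    show "inf (a + b) c - a \<le> b" by (simp add: diff_le_eq add.commute le_infI1)
    show "inf (a + b) c - a \<le> c" using pos by (metis diff_le_eq inf.coboundedI2 le_add_same_cancel1)
  qed
  then have "inf (a + b) c \<le> a" using assms(2) by simp
  then have "inf (a + b) c \<le> inf a c" by simp
  then show ?thesis using assms(1) pos by (metis add_nonneg_nonneg le_inf_iff order.antisym)
qed

lemma inf_scaleR_eq_0:
  fixes a b :: "'a::riesz_space"
  assumes "inf a b = 0"
  shows "inf (real n *\<^sub>R a) b = 0"
proof (induction n)
  case 0
  then show ?case using assms by (metis inf.absorb1 inf.cobounded2 of_nat_0 scaleR_zero_left)
next
  case (Suc n)
  then show ?case using inf_add_eq_0[OF assms Suc] by (simp add: algebra_simps)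
qed

lemma inf_pprt_nprt: "inf (pprt x) (- nprt x) = 0" for x :: "'a::lattice_ab_group_add"
proof -
  have "inf (pprt x) (- nprt x) = inf (x - nprt x) (0 - nprt x)"
    using prts[of x] by (metis add_diff_cancel_right' diff_0)
  also have "\<dots> = inf x 0 - nprt x"
    using add_inf_distrib_right[of x 0 "- nprt x"] by (simp del: neg_inf_eq_sup diff_inf_eq_sup)
  finally show ?thesis by (simp add: nprt_def)
qed

text \<open>The component \<open>p\<close> is the projection of \<open>x\<close> onto the band generated by \<open>(y - x)\<^sup>+\<close>.\<close>

lemma component_step:
  fixes x y :: "'a::{riesz_space,conditionally_complete_lattice}"
  assumes V: "riesz_subspace V"
    and cl: "\<And>D s. D \<subseteq> V \<Longrightarrow> up_directed D \<Longrightarrow> isLub UNIV D s \<Longrightarrow> s \<in> V"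
    and "x \<in> V" "y \<in> V" and x0: "0 \<le> x" and y0: "0 \<le> y" and yx: "y \<le> c *\<^sub>R x" and c: "2 \<le> c"
  obtains p where "p \<in> V" "0 \<le> p" "inf p (x - p) = 0" "0 \<le> y - p" "y - p \<le> (c - 1) *\<^sub>R x"
proof -
  define w where "w = pprt (y - x)"
  define v where "v m = inf x (real m *\<^sub>R w)" for m :: nat
  define p where "p = Sup (range v)"
  have sub: "subspace V" and lat: "\<And>x y. x \<in> V \<Longrightarrow> y \<in> V \<Longrightarrow> sup x y \<in> V \<and> inf x y \<in> V"
    using V by (auto simp: riesz_subspace_def)
  have w0: "0 \<le> w" by (simp add: w_def)
  have v_mono: "v m \<le> v n" if "m \<le> n" for m n
    unfolding v_def by (intro inf_mono order_refl scaleR_right_mono) (use that w0 in auto)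
  have v0: "0 \<le> v m" for m unfolding v_def using x0 w0 by (simp add: scaleR_nonneg_nonneg)
  have lub: "isLub UNIV (range v) p"
    unfolding p_def by (rule isLub_Sup) (auto simp: v_def intro!: bdd_aboveI[of _ x])
  have vp: "v m \<le> p" for m using lub by (auto simp: isLub_UNIV_iff)
  have p_le: "p \<le> b" if "\<And>m. v m \<le> b" for b using lub that by (auto simp: isLub_UNIV_iff)
  have "w \<in> V" unfolding w_def pprt_def using lat sub \<open>x \<in> V\<close> \<open>y \<in> V\<close>
    by (simp add: subspace_diff subspace_0)
  then have "range v \<subseteq> V" unfolding v_def using lat sub \<open>x \<in> V\<close> by (auto simp: subspace_scale)
  then have pV: "p \<in> V" using cl[OF _ up_directed_mono_seq lub] v_mono by blast
  have p0: "0 \<le> p" using v0[of 0] vp[of 0] by simp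
  have px: "p \<le> x" by (rule p_le) (simp add: v_def)
  \<comment> \<open>The overlap \<open>t\<close> can be added to any \<open>v m\<close> without
    exceeding \<open>v (Suc m)\<close>, so \<open>p - t\<close> is still an upper bound of the
    sequence.\<close>
  have qw: "inf (x - p) w = 0"
  proof -
    define t where "t = inf (x - p) w"
    have t0: "0 \<le> t" using px w0 by (simp add: t_def)
    have "p \<le> p - t"
    proof (rule p_le)
      fix m
      have "v m + t \<le> v (Suc m)"
      proof -
        have "v m + t \<le> p + (x - p)" unfolding t_def by (intro add_mono vp) simp
        moreover have "v m + t \<le> real m *\<^sub>R w + w" unfolding t_def v_def by (intro add_mono) simp_all
        ultimately show ?thesis by (simp add: v_def[of "Suc m"] algebra_simps)
      qed
      then have "v m + t \<le> p" using vp order_trans by blast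
      then show "v m \<le> p - t" by (simp add: algebra_simps)
    qed
    then show ?thesis using t0 by (simp add: t_def[symmetric] order.antisym)
  qed
  \<comment> \<open>Each \<open>v m\<close> lies below a multiple of \<open>w\<close>, hence is
    disjoint from \<open>x - p\<close>; distributivity carries this over to the supremum
    \<open>p\<close>.\<close>
  have pq: "inf p (x - p) = 0"
  proof -
    have "inf (inf p (x - p)) (v m) = 0" for m
      using inf_eq_0_mono[OF inf_scaleR_eq_0[OF qw[unfolded inf_commute[of "x - p"]], of m]]
        v0[of m] p0 px by (subst inf_commute) (simp add: v_def)
    then have "inf (inf p (x - p)) ` range v = {0}" unfolding image_image by simp
    moreover have "isLub UNIV (inf (inf p (x - p)) ` range v) (inf p (x - p))"
      by (rule isLub_inf_left[OF lub]) simp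
    ultimately have "isLub UNIV {0} (inf p (x - p))" by simp
    then show ?thesis by (intro isLub_UNIV_unique[of "{0}"]) (auto simp: isLub_UNIV_iff)
  qed
  \<comment> \<open>The excess of \<open>v m\<close> over \<open>y\<close> lies below a multiple of
    the positive part of \<open>y - x\<close> and also below its negative part.\<close>
  have "p \<le> y"
  proof (rule p_le)
    fix m
    have "pprt (v m - y) \<le> real m *\<^sub>R w"
      using v0 y0 w0 unfolding pprt_def
      by (auto simp: v_def scaleR_nonneg_nonneg diff_le_eq intro: add_increasing2 le_infI2)
    moreover have "pprt (v m - y) \<le> - nprt (y - x)"
    proof -
      have "pprt (v m - y) \<le> pprt (x - y)" by (intro pprt_mono diff_right_mono) (simp add: v_def)
      then show ?thesis using pprt_neg[of "y - x"] by simp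
    qed
    ultimately have "pprt (v m - y) \<le> inf (real m *\<^sub>R w) (- nprt (y - x))" by simp
    also have "\<dots> = 0" unfolding w_def by (rule inf_scaleR_eq_0[OF inf_pprt_nprt])
    finally have "v m - y \<le> 0" by (simp add: pprt_def)
    then show "v m \<le> y" by simp
  qed
  \<comment> \<open>The excess over \<open>(c - 1) x\<close> lies below both \<open>x - p\<close>
    and \<open>w\<close>, which are disjoint. The bound by \<open>w\<close> uses
    \<open>c - 1 \<ge> 1\<close>.\<close>
  moreover have "y - p \<le> (c - 1) *\<^sub>R x"
  proof -
    have "y - p - (c - 1) *\<^sub>R x \<le> x - p" using yx by (simp add: algebra_simps)
    moreover have "y - p - (c - 1) *\<^sub>R x \<le> w"
    proof -
      have "1 *\<^sub>R x \<le> (c - 1) *\<^sub>R x" using c x0 by (intro scaleR_right_mono) auto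
      then have "y - p - (c - 1) *\<^sub>R x \<le> y - x"
        using p0 by (simp add: algebra_simps add_mono add_increasing)
      also have "\<dots> \<le> w" by (simp add: w_def pprt_def)
      finally show ?thesis .
    qed
    ultimately have "y - p - (c - 1) *\<^sub>R x \<le> inf (x - p) w" by simp
    then show ?thesis using qw by simp
  qed
  ultimately show ?thesis using that pV p0 pq by simp
qed

text \<open>Each step removes one component of \<open>x\<close> and lowers the bound by one copy of
  \<open>x\<close>, until a remainder in \<open>[0, x]\<close> is left. \<open>C\<close> stands for
  any property that survives adding a component, so no list of components is recorded;
  \<open>cl\<close> keeps the components inside \<open>V\<close>.\<close>

lemma component_approximation:
  fixes x y :: "'a::{riesz_space,conditionally_complete_lattice}"
  assumes V: "riesz_subspace V"
    and cl: "\<And>D s. D \<subseteq> V \<Longrightarrow> up_directed D \<Longrightarrow> isLub UNIV D s \<Longrightarrow> s \<in> V"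
    and x: "x \<in> V" "0 \<le> x" and y: "y \<in> V" "0 \<le> y" "y \<le> real (Suc n) *\<^sub>R x"
    and C0: "C 0"
    and C_add: "\<And>p c. p \<in> V \<Longrightarrow> 0 \<le> p \<Longrightarrow> inf p (x - p) = 0 \<Longrightarrow> C c \<Longrightarrow> C (p + c)"
  shows "\<exists>c r. y = c + r \<and> C c \<and> r \<in> V \<and> 0 \<le> r \<and> r \<le> x"
  using y
proof (induction n arbitrary: y)
  case 0
  then show ?case using C0 by (intro exI[of _ 0] exI[of _ y]) simp
next
  case (Suc n)
  obtain p where p: "p \<in> V" "0 \<le> p" "inf p (x - p) = 0" "0 \<le> y - p"
    "y - p \<le> (real (Suc (Suc n)) - 1) *\<^sub>R x"
    by (rule component_step[OF V cl x(1) Suc.prems(1) x(2) Suc.prems(2,3)]) auto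
  have "y - p \<in> V" using V p(1) Suc.prems(1) by (simp add: riesz_subspace_def subspace_diff)
  moreover have "y - p \<le> real (Suc n) *\<^sub>R x" using p(5) by simp
  ultimately obtain c r where "y - p = c + r" "C c" "r \<in> V" "0 \<le> r" "r \<le> x"
    using Suc.IH p(4) by blast
  then show ?case using C_add[OF p(1-3)]
    by (intro exI[of _ "p + c"] exI[of _ r]) (simp add: algebra_simps)
qed

section \<open>Unital f-algebras\<close>

text \<open>Applying the f-algebra axiom once on each side turns both arguments of the infimum into
  \<open>x * y\<close>.\<close>

lemma disjoint_imp_mult_eq_0:
  fixes x y :: "'a::f_algebra"
  assumes "inf x y = 0"
  shows "x * y = 0"
proof -
  have "0 \<le> x" "0 \<le> y" using assms by (metis inf.cobounded1 inf.cobounded2)+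
  then have "inf (x * y) (x * y) = 0"
    using assms by (metis f_mult_left f_mult_right inf_commute)
  then show ?thesis by simp
qed

lemma
  fixes x :: "'a::f_algebra"
  shows pprt_mult_nprt: "pprt x * nprt x = 0" and nprt_mult_pprt: "nprt x * pprt x = 0"
proof -
  have "inf (- nprt x) (pprt x) = 0" using inf_pprt_nprt[of x] by (simp only: inf_commute)
  from disjoint_imp_mult_eq_0[OF this] disjoint_imp_mult_eq_0[OF inf_pprt_nprt[of x]]
  show "pprt x * nprt x = 0" "nprt x * pprt x = 0" by simp_all
qed

lemma square_prts: "x * x = pprt x * pprt x + nprt x * nprt x" for x :: "'a::f_algebra"
  by (subst (1 2) prts[of x]) (simp add: distrib_left distrib_right pprt_mult_nprt nprt_mult_pprt)

lemma square_nonneg: "0 \<le> x * x" for x :: "'a::f_algebra"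
  unfolding square_prts[of x] by (simp add: mult_nonpos_nonpos)

lemma abs_mult_self: "\<bar>x\<bar> * \<bar>x\<bar> = x * x" for x :: "'a::f_algebra"
  unfolding square_prts[of x] abs_prts
  by (simp add: left_diff_distrib right_diff_distrib pprt_mult_nprt nprt_mult_pprt)

text \<open>The Birkhoff--Pierce estimate \<open>n \<bar>xy - yx\<bar> \<le> x\<^sup>2\<close> for \<open>0 \<le> y \<le> x\<close>: up to an error at most
  \<open>x\<close>, the element \<open>n y\<close> is a sum of components of \<open>x\<close>, and components of \<open>x\<close> commute with \<open>x\<close>.\<close>

lemma commutator_estimate:
  fixes x y :: "'a::{f_algebra,conditionally_complete_lattice}"
  assumes "0 \<le> y" "y \<le> x"
  shows "real n *\<^sub>R (x * y - y * x) \<le> x * x" "real n *\<^sub>R (y * x - x * y) \<le> x * x"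
proof -
  have x0: "0 \<le> x" using assms by simp
  have "real n *\<^sub>R y \<le> real n *\<^sub>R x" using assms by (intro scaleR_left_mono) auto
  also have "\<dots> \<le> real (Suc n) *\<^sub>R x" using x0 by (intro scaleR_right_mono) auto
  finally have "real n *\<^sub>R y \<le> real (Suc n) *\<^sub>R x" .
  moreover have "0 \<le> real n *\<^sub>R y" using assms by (simp add: scaleR_nonneg_nonneg)
  moreover have "x * (p + c) = (p + c) * x" if "inf p (x - p) = 0" "x * c = c * x" for p c
  proof -
    have "inf (x - p) p = 0" using that by (simp only: inf_commute)
    with disjoint_imp_mult_eq_0[OF that(1)] disjoint_imp_mult_eq_0[OF this]
    have "p * x = p * p" "x * p = p * p" by (simp_all add: algebra_simps)
    then show ?thesis using that(2) by (simp add: algebra_simps)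
  qed
  ultimately obtain c r where cr: "real n *\<^sub>R y = c + r" "x * c = c * x" "0 \<le> r" "r \<le> x"
    using component_approximation[of UNIV x "real n *\<^sub>R y" n "\<lambda>c. x * c = c * x"] x0
    by (auto simp: riesz_subspace_def)
  have "real n *\<^sub>R (x * y - y * x) = x * (real n *\<^sub>R y) - (real n *\<^sub>R y) * x"
    by (simp add: algebra_simps)
  also have "\<dots> = x * r - r * x" using cr(1,2) by (simp add: algebra_simps)
  finally have eq: "real n *\<^sub>R (x * y - y * x) = x * r - r * x" .
  have "0 \<le> r * x" "0 \<le> x * r" "x * r \<le> x * x" "r * x \<le> x * x"
    using cr(3,4) x0 by (simp_all add: mult_left_mono mult_right_mono)
  then have "x * r - r * x \<le> x * x" "r * x - x * r \<le> x * x"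
    by (simp_all only: diff_le_eq add_increasing2)
  moreover have "real n *\<^sub>R (y * x - x * y) = r * x - x * r"
    using arg_cong[OF eq, of uminus] by (simp add: algebra_simps)
  ultimately show "real n *\<^sub>R (x * y - y * x) \<le> x * x" "real n *\<^sub>R (y * x - x * y) \<le> x * x"
    using eq by simp_all
qed

text \<open>For positive elements, \<open>y\<close> lies in \<open>[0, x + y]\<close>, and its
  commutator with \<open>x + y\<close> is its commutator with \<open>x\<close>. Positive and
  negative parts do the rest.\<close>

lemma f_algebra_mult_commute:
  fixes x y :: "'a::{f_algebra,conditionally_complete_lattice}"
  shows "x * y = y * x"
proof -
  have pos: "x * y = y * x" if "0 \<le> x" "0 \<le> y" for x y :: 'a
  proof -
    have "y * (x + y) = (x + y) * y" using that
      by (intro archimedean_eqI[of _ _ "(x + y) * (x + y)"] commutator_estimate) simp_all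
    then show ?thesis by (simp add: algebra_simps)
  qed
  have "pprt x * pprt y = pprt y * pprt x" "(- nprt x) * (- nprt y) = (- nprt y) * (- nprt x)"
    "pprt x * (- nprt y) = (- nprt y) * pprt x" "(- nprt x) * pprt y = pprt y * (- nprt x)"
    by (intro pos; simp)+
  then have "(pprt x + nprt x) * (pprt y + nprt y) = (pprt y + nprt y) * (pprt x + nprt x)"
    by (simp add: distrib_left distrib_right algebra_simps)
  then show ?thesis by (simp add: prts[symmetric])
qed

locale unital_f_algebra =
  fixes e :: "'a::{f_algebra,conditionally_complete_lattice}"
  assumes unit_left [simp]: "e * x = x" and unit_right [simp]: "x * e = x"
begin

lemma unit_nonneg [simp]: "0 \<le> e"
  using square_nonneg[of e] by simp

text \<open>The square of \<open>x - (c / 2) e\<close> is nonnegative; this yields the coefficient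
  \<open>c / 4\<close>, relaxed to \<open>c\<close>. Large \<open>c\<close> bounds \<open>x\<close>
  by a multiple of \<open>e\<close> up to a small error, and small \<open>c\<close> shows that
  elements of square 0 are infinitesimal.\<close>

lemma linear_le_square:
  fixes x :: 'a
  assumes "0 < c"
  shows "x \<le> c *\<^sub>R e + (1 / c) *\<^sub>R (x * x)"
proof -
  have "0 \<le> (1 / c) *\<^sub>R ((x - (c / 2) *\<^sub>R e) * (x - (c / 2) *\<^sub>R e))"
    using assms square_nonneg by (intro scaleR_nonneg_nonneg) auto
  also have "\<dots> = (1 / c) *\<^sub>R (x * x) - x + (c / 4) *\<^sub>R e"
    using assms by (simp add: algebra_simps flip: scaleR_add_left)
  finally have "x \<le> (c / 4) *\<^sub>R e + (1 / c) *\<^sub>R (x * x)" by (simp add: algebra_simps)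
  also have "\<dots> \<le> c *\<^sub>R e + (1 / c) *\<^sub>R (x * x)"
    using assms by (intro add_right_mono scaleR_right_mono) auto
  finally show ?thesis .
qed

lemma square_eq_0_imp:
  fixes x :: 'a
  assumes "x * x = 0"
  shows "x = 0"
proof -
  have "real n *\<^sub>R y \<le> e" if "y * y = 0" for n and y :: 'a
  proof (cases "n = 0")
    case False
    then have "y \<le> (1 / real n) *\<^sub>R e" using linear_le_square[of "1 / real n" y] that by simp
    then have "real n *\<^sub>R y \<le> real n *\<^sub>R ((1 / real n) *\<^sub>R e)" by (intro scaleR_left_mono) auto
    then show ?thesis using False by simp
  qed simp
  then have "y \<le> 0" if "y * y = 0" for y :: 'a using that archimedean_nonpos[of y e] by blast
  from this[of x] this[of "- x"] have "x \<le> 0" "- x \<le> 0" using assms by simp_all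
  then show ?thesis by simp
qed

lemma nonneg_square_eq_imp:
  fixes r s :: 'a
  assumes "0 \<le> r" "0 \<le> s" "r * r = s * s"
  shows "r = s"
proof -
  define d where "d = r - s"
  have "d * (r + s) = 0" using assms(3) f_algebra_mult_commute[of r s]
    by (simp add: d_def algebra_simps)
  \<comment> \<open>The factor \<open>r + s\<close> cannot be cancelled, but one more factor
    \<open>d\<close> makes both summands nonnegative, so each is 0; their difference is the cube of
    \<open>d\<close>.\<close>
  then have "d * d * r + d * d * s = 0" by (metis distrib_left mult.assoc mult_zero_right)
  moreover have "0 \<le> d * d * r" "0 \<le> d * d * s" using assms square_nonneg[of d] by simp_all
  ultimately have "d * d * r = 0" "d * d * s = 0" by (simp_all add: add_nonneg_eq_0_iff)
  then have "d * d * d = 0" by (simp add: d_def algebra_simps)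
  then have "(d * d) * (d * d) = 0" by (metis mult.assoc mult_zero_left)
  then have "d = 0" using square_eq_0_imp by blast
  then show ?thesis by (simp add: d_def)
qed

lemma abs_mult_eq: "\<bar>x * y\<bar> = \<bar>x\<bar> * \<bar>y\<bar>" for x y :: 'a
proof (rule nonneg_square_eq_imp)
  have "\<bar>x\<bar> * \<bar>y\<bar> * (\<bar>x\<bar> * \<bar>y\<bar>) = (\<bar>x\<bar> * \<bar>x\<bar>) * (\<bar>y\<bar> * \<bar>y\<bar>)"
    by (metis f_algebra_mult_commute mult.assoc)
  also have "\<dots> = x * x * (y * y)" by (simp add: abs_mult_self)
  also have "\<dots> = x * y * (x * y)" by (metis f_algebra_mult_commute mult.assoc)
  finally show "\<bar>x * y\<bar> * \<bar>x * y\<bar> = \<bar>x\<bar> * \<bar>y\<bar> * (\<bar>x\<bar> * \<bar>y\<bar>)" by (simp add: abs_mult_self)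
qed simp_all

text \<open>Multiplication by \<open>c\<close> is order continuous because \<open>c \<le> n e + c\<^sup>2/n\<close> dominates it by a
  multiple of the identity up to an arbitrarily small error.\<close>

lemma isLub_mult_left:
  fixes c f :: 'a
  assumes D: "up_directed D" and lub: "isLub UNIV D f" and c: "0 \<le> c"
  shows "isLub UNIV ((*) c ` D) (c * f)"
proof -
  have le: "d \<le> f" if "d \<in> D" for d using lub that by (simp add: isLub_UNIV_iff)
  have "c * f \<le> b" if b: "\<And>d. d \<in> D \<Longrightarrow> c * d \<le> b" for b
  proof -
    obtain d0 where d0: "d0 \<in> D" using D by (auto simp: up_directed_def)
    have "real n *\<^sub>R (c * f - b) \<le> c * c * (f - d0)" for n
    proof (cases "n = 0")
      case True
      then show ?thesis using c le[OF d0] by simp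
    next
      case False
      define m where "m = real n"
      \<comment> \<open>Chosen so that \<open>f - t\<close> bounds \<open>D\<close>. Going through
        some \<open>d'\<close> above both \<open>d\<close> and \<open>d0\<close> freezes the error
        at \<open>c * c * (f - d0)\<close>, independent of \<open>d\<close> and \<open>m\<close>;
        the claim is \<open>t \<le> 0\<close> multiplied by \<open>m * m\<close>.\<close>
      define t where "t = (1 / m) *\<^sub>R (c * f - b - (1 / m) *\<^sub>R (c * c * (f - d0)))"
      have m: "0 < m" using False by (simp add: m_def)
      have "d \<le> f - t" if "d \<in> D" for d
      proof -
        obtain d' where d': "d' \<in> D" "d \<le> d'" "d0 \<le> d'"
          using D \<open>d \<in> D\<close> d0 unfolding up_directed_def by meson
        have "c * f - b \<le> c * (f - d')" using b[OF d'(1)] by (simp add: algebra_simps)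
        also have "\<dots> \<le> (m *\<^sub>R e + (1 / m) *\<^sub>R (c * c)) * (f - d')"
          using linear_le_square[OF m] le[OF d'(1)] by (intro mult_right_mono) auto
        also have "\<dots> = m *\<^sub>R (f - d') + (1 / m) *\<^sub>R (c * c * (f - d'))"
          by (simp add: distrib_right)
        also have "\<dots> \<le> m *\<^sub>R (f - d) + (1 / m) *\<^sub>R (c * c * (f - d0))"
          using m d' square_nonneg
          by (intro add_mono scaleR_left_mono mult_left_mono) auto
        finally have "c * f - b - (1 / m) *\<^sub>R (c * c * (f - d0)) \<le> m *\<^sub>R (f - d)"
          by (simp only: diff_le_eq)
        then have "t \<le> (1 / m) *\<^sub>R (m *\<^sub>R (f - d))"
          unfolding t_def using m by (intro scaleR_left_mono) auto
        also have "\<dots> = f - d" using m by simp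
        finally show ?thesis by (metis add.commute le_diff_eq)
      qed
      then have "f \<le> f - t"
        using lub unfolding isLub_UNIV_iff by blast
      then have "t \<le> 0" by simp
      then have "(m * m) *\<^sub>R (t) \<le> (m * m) *\<^sub>R 0"
        using m by (intro scaleR_left_mono) auto
      then show ?thesis using m by (simp add: t_def scaleR_diff_right m_def[symmetric])
    qed
    then have "c * f - b \<le> 0" by (rule archimedean_nonpos)
    then show ?thesis by simp
  qed
  then show ?thesis using le c by (auto simp: isLub_UNIV_iff intro: mult_left_mono)
qed

section \<open>Truncations and square roots\<close>

definition trunc :: "'a \<Rightarrow> nat \<Rightarrow> 'a" where
  "trunc x n = inf x (real n *\<^sub>R e)"

lemma trunc_le: "trunc x n \<le> x" "trunc x n \<le> real n *\<^sub>R e"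
  by (simp_all add: trunc_def)

lemma trunc_nonneg: "0 \<le> x \<Longrightarrow> 0 \<le> trunc x n"
  by (simp add: trunc_def scaleR_nonneg_nonneg)

lemma trunc_mono: "m \<le> n \<Longrightarrow> trunc x m \<le> trunc x n"
  unfolding trunc_def by (intro inf_mono order_refl scaleR_right_mono) auto

lemma up_directed_trunc: "up_directed (range (trunc x))"
  by (rule up_directed_mono_seq) (rule trunc_mono)

text \<open>For \<open>n > 0\<close>, \<open>linear_le_square\<close> with \<open>c = n\<close> puts
  \<open>x - x\<^sup>2 / n\<close> below \<open>trunc x n\<close>, so every upper bound
  \<open>b\<close> satisfies \<open>n (x - b) \<le> x\<^sup>2\<close>.\<close>

lemma isLub_trunc: "isLub UNIV (range (trunc x)) x"
proof -
  have "x \<le> b" if b: "\<And>n. trunc x n \<le> b" for b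
  proof -
    have "real n *\<^sub>R (x - b) \<le> x * x" for n
    proof (cases "n = 0")
      case True then show ?thesis by (simp add: square_nonneg)
    next
      case False
      have "x - (1 / real n) *\<^sub>R (x * x) \<le> trunc x n"
        unfolding trunc_def using linear_le_square[of "real n" x] False square_nonneg[of x]
        by (simp add: algebra_simps scaleR_nonneg_nonneg)
      also have "\<dots> \<le> b" by (rule b)
      finally have "x - b \<le> (1 / real n) *\<^sub>R (x * x)" by (simp add: algebra_simps)
      then have "real n *\<^sub>R (x - b) \<le> real n *\<^sub>R ((1 / real n) *\<^sub>R (x * x))"
        by (intro scaleR_left_mono) auto
      then show ?thesis using False by simp
    qed
    then have "x - b \<le> 0" by (rule archimedean_nonpos)
    then show ?thesis by simp
  qed
  then show ?thesis by (auto simp: isLub_UNIV_iff trunc_le)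
qed

lemma disjoint_unit_imp_eq_0:
  fixes x :: 'a
  assumes "inf e x = 0"
  shows "x = 0"
proof -
  have "e * x = 0" by (rule disjoint_imp_mult_eq_0[OF assms])
  then show ?thesis by simp
qed

text \<open>If \<open>r = sup {c \<in> V\<^sub>+. c\<^sup>2 \<le> b}\<close> had \<open>u = b - r\<^sup>2 > 0\<close>, then \<open>r + v/n\<close> with
  \<open>v = e \<and> (n u - 2 r - e)\<^sup>+\<close> would still belong to that set for every \<open>n\<close>.\<close>

lemma square_root_exists:
  fixes b :: 'a
  assumes V: "riesz_subspace V"
    and cl: "\<And>D s. D \<subseteq> V \<Longrightarrow> up_directed D \<Longrightarrow> isLub UNIV D s \<Longrightarrow> s \<in> V"
    and mult: "\<And>x y. x \<in> V \<Longrightarrow> y \<in> V \<Longrightarrow> x * y \<in> V"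
    and e: "e \<in> V" and b: "b \<in> V" "0 \<le> b"
  shows "\<exists>r\<in>V. 0 \<le> r \<and> r * r = b"
proof -
  define S where "S = {c \<in> V. 0 \<le> c \<and> c * c \<le> b}"
  define r where "r = Sup S"
  have sub: "subspace V" and lat: "\<And>x y. x \<in> V \<Longrightarrow> y \<in> V \<Longrightarrow> sup x y \<in> V \<and> inf x y \<in> V"
    using V by (auto simp: riesz_subspace_def)
  have "0 \<in> S" using b sub by (simp add: S_def subspace_0)
  have bound: "c \<le> e + b" if "c \<in> S" for c
    using linear_le_square[of 1 c] that by (simp add: S_def) (meson add_left_mono order_trans)
  \<comment> \<open>\<open>s - c\<close> and \<open>s - d\<close> are disjoint and stay so after
    multiplication by nonnegative factors; \<open>s * s - b\<close> lies below both
    products.\<close>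
  have sup_S: "sup c d \<in> S" if "c \<in> S" "d \<in> S" for c d
  proof -
    define s where "s = sup c d"
    have nn: "0 \<le> c" "0 \<le> d" "0 \<le> s" using that by (auto simp: S_def s_def le_supI1)
    have "inf (s - c) (s - d) = 0"
      using add_inf_distrib_left[of s "- c" "- d"] by (simp add: s_def flip: neg_sup_eq_inf)
    then have "inf ((s + c) * (s - c)) (s - d) = 0" using nn by (intro f_mult_left) simp_all
    then have "inf (s - d) ((s + c) * (s - c)) = 0" by (simp only: inf_commute)
    then have disj: "inf ((s + d) * (s - d)) ((s + c) * (s - c)) = 0"
      using nn by (intro f_mult_left) simp_all
    have "s * s - c * c = (s + c) * (s - c)" "s * s - d * d = (s + d) * (s - d)"
      using f_algebra_mult_commute[of s c] f_algebra_mult_commute[of s d]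
      by (simp_all add: algebra_simps)
    moreover have "s * s - b \<le> s * s - c * c" "s * s - b \<le> s * s - d * d"
      using that by (simp_all add: S_def)
    ultimately have "s * s - b \<le> inf ((s + d) * (s - d)) ((s + c) * (s - c))" by simp
    then have "s * s \<le> b" using disj by simp
    then show ?thesis using that nn lat by (simp add: S_def s_def)
  qed
  have dir: "up_directed S"
    unfolding up_directed_def using \<open>0 \<in> S\<close> sup_S by (metis empty_iff sup.cobounded1 sup.cobounded2)
  have lub: "isLub UNIV S r"
    unfolding r_def using \<open>0 \<in> S\<close> bound by (intro isLub_Sup) (auto intro!: bdd_aboveI[of _ "e + b"])
  have le_r: "c \<le> r" if "c \<in> S" for c using lub that by (simp add: isLub_UNIV_iff)
  have r0: "0 \<le> r" using le_r \<open>0 \<in> S\<close> by simp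
  have rV: "r \<in> V" using cl[OF _ dir lub] by (auto simp: S_def)
  \<comment> \<open>Mixed products are bounded first because \<open>r * r\<close> is reached by two
    successive suprema, one in each factor.\<close>
  have "c * d \<le> b" if "c \<in> S" "d \<in> S" for c d
  proof -
    have "c * d \<le> sup c d * sup c d" using that by (intro mult_mono) (auto simp: S_def le_supI1)
    also have "\<dots> \<le> b" using sup_S[OF that] by (simp add: S_def)
    finally show ?thesis .
  qed
  then have "c * r \<le> b" if "c \<in> S" for c
    using isLub_mult_left[OF dir lub, of c] that by (auto simp: isLub_UNIV_iff S_def)
  then have "r * c \<le> b" if "c \<in> S" for c using that f_algebra_mult_commute[of r c] by simp
  then have rr: "r * r \<le> b"
    using isLub_mult_left[OF dir lub r0] by (auto simp: isLub_UNIV_iff)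
  define u where "u = b - r * r"
  \<comment> \<open>For \<open>z\<close> in \<open>[0, e]\<close>, enlarging \<open>r\<close> by
    \<open>z\<close> raises its square by at most \<open>z * w\<close>.\<close>
  define w where "w = r + r + e"
  have u0: "0 \<le> u" using rr by (simp add: u_def)
  have uV: "u \<in> V" using b rV mult sub by (simp add: u_def subspace_diff)
  have wV: "w \<in> V" using e rV sub by (simp add: w_def subspace_add)
  have "real n *\<^sub>R u \<le> w" for n
  proof (cases "n = 0")
    case True
    then show ?thesis using r0 by (simp add: w_def)
  next
    case False
    define x where "x = real n *\<^sub>R u - w"
    define v where "v = inf e (pprt x)"
    define z where "z = (1 / real n) *\<^sub>R v"
    have xV: "x \<in> V" using uV wV sub by (simp add: x_def subspace_diff subspace_scale)
    have v: "0 \<le> v" "v \<le> e" "v \<in> V"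
      using xV e lat sub by (auto simp: v_def pprt_def subspace_0)
    have nz: "real n *\<^sub>R z = v" using False by (simp add: z_def)
    have z: "0 \<le> z" "z \<le> v" "z \<in> V"
    proof -
      show "0 \<le> z" "z \<in> V" using v sub by (simp_all add: z_def scaleR_nonneg_nonneg subspace_scale)
      have "(1 / real n) *\<^sub>R v \<le> 1 *\<^sub>R v" using False v by (intro scaleR_right_mono) auto
      then show "z \<le> v" by (simp add: z_def)
    qed
    have "inf v (- nprt x) = 0"
      using v by (intro inf_eq_0_mono[OF inf_pprt_nprt[of x]]) (simp_all add: v_def)
    from disjoint_imp_mult_eq_0[OF this] have "v * nprt x = 0" by simp
    \<comment> \<open>\<open>v\<close> is supported where \<open>n u\<close> dominates
      \<open>w\<close>, so after division by \<open>n\<close> the increment \<open>z * w\<close>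
      fits into the gap \<open>u\<close>.\<close>
    then have "v * x = v * pprt x" by (subst prts[of x]) (simp add: distrib_left)
    then have "0 \<le> v * x" using v by simp
    then have "v * w \<le> real n *\<^sub>R (v * u)" by (simp add: x_def algebra_simps)
    also have "\<dots> \<le> real n *\<^sub>R (e * u)"
      using v u0 by (intro scaleR_left_mono mult_right_mono) auto
    finally have "(1 / real n) *\<^sub>R (v * w) \<le> (1 / real n) *\<^sub>R (real n *\<^sub>R u)"
      by (intro scaleR_left_mono) auto
    then have "z * w \<le> u" using False by (simp add: z_def)
    moreover have "z * z \<le> z * e" using z v by (intro mult_left_mono) auto
    ultimately have "z * (r + r) + z * z \<le> u"
      using order_trans[OF add_left_mono[of "z * z" "z * e" "z * (r + r)"]]
      by (simp add: w_def distrib_left)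
    then have "(r + z) * (r + z) \<le> b"
      using f_algebra_mult_commute[of r z] by (simp add: u_def algebra_simps)
    then have "r + z \<in> S" using r0 z rV sub by (simp add: S_def subspace_add)
    then have "z \<le> 0" using le_r by fastforce
    then have "v = 0" using z nz by (simp add: order.antisym)
    then have "pprt x = 0" unfolding v_def by (rule disjoint_unit_imp_eq_0)
    then have "x \<le> 0" by (simp add: le_zero_iff_zero_pprt)
    then show ?thesis by (simp add: x_def)
  qed
  then have "u \<le> 0" by (rule archimedean_nonpos)
  then have "r * r = b" using u0 by (simp add: u_def)
  then show ?thesis using rV r0 by blast
qed

end

section \<open>The extended conditional expectation\<close>

locale extended_conditional_expectation =
  unital_f_algebra e for e :: "'u::universally_complete_f_algebra" +
  fixes E :: "'u set" and T :: "'u \<Rightarrow> 'u"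
  assumes universal_completion: "universal_completion_of E"
    and dedekind_complete: "dedekind_complete_on E"
    and unit_in_E: "e \<in> E"
    and cond_exp: "conditional_expectation_on E T"
    and T_unit: "T e = e"
    and strictly_positive: "strictly_positive_on E T"
begin

section \<open>The ideal \<open>E\<close> in its universal completion\<close>

lemma subspace_E: "subspace E"
  using universal_completion by (simp add: universal_completion_of_def riesz_subspace_def)

lemma sup_in_E: "x \<in> E \<Longrightarrow> y \<in> E \<Longrightarrow> sup x y \<in> E"
  using universal_completion by (simp add: universal_completion_of_def riesz_subspace_def)

text \<open>For \<open>f \<ge> 0\<close> this is the largest set increasing to \<open>f\<close> in
  the sense of \<open>increases_to\<close>, hence a canonical approximation.\<close>

definition below :: "'u \<Rightarrow> 'u set" where
  "below f = {x \<in> E. 0 \<le> x \<and> x \<le> f}"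

text \<open>If \<open>b\<close> bounded the set without dominating \<open>f\<close>, order density
  would give \<open>x > 0\<close> in \<open>E\<close> below the gap \<open>f - inf b f\<close>.
  Inductively every multiple of \<open>x\<close> then stays below \<open>f\<close>, against the
  Archimedean property.\<close>

lemma isLub_below:
  assumes "0 \<le> f"
  shows "isLub UNIV (below f) f"
proof -
  have "f \<le> b" if b: "\<And>x. x \<in> below f \<Longrightarrow> x \<le> b" for b
  proof (rule ccontr)
    assume "\<not> f \<le> b"
    define c where "c = inf b f"
    have "c < f" unfolding c_def using \<open>\<not> f \<le> b\<close> by (metis inf.cobounded1 inf_le2 order_less_le)
    then obtain x where x: "x \<in> E" "0 < x" "x \<le> f - c"
      using universal_completion unfolding universal_completion_of_def order_dense_def
      by (metis diff_gt_0_iff_gt)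
    have "real n *\<^sub>R x \<in> below f" for n
    proof (induction n)
      case 0
      then show ?case using assms subspace_E by (simp add: below_def subspace_0)
    next
      case (Suc n)
      then have "real n *\<^sub>R x \<le> c" using b[OF Suc] by (simp add: c_def below_def)
      then have "real n *\<^sub>R x + x \<le> f" using add_mono[OF _ x(3)] by fastforce
      moreover have "real (Suc n) *\<^sub>R x = real n *\<^sub>R x + x" by (simp add: algebra_simps)
      ultimately show ?case
        using x subspace_E Suc by (simp add: below_def subspace_scale subspace_add)
    qed
    then have "real n *\<^sub>R x \<le> f" for n by (simp add: below_def)
    then have "x \<le> 0" by (rule archimedean_nonpos)
    then show False using x by simp
  qed
  then show ?thesis by (auto simp: isLub_UNIV_iff below_def)
qed

text \<open>The supremum \<open>s\<close> of \<open>below g\<close> relative to \<open>E\<close>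
  must be \<open>g\<close> itself: an element of \<open>E\<close> in the gap \<open>s - g\<close>
  could be subtracted from \<open>s\<close>.\<close>

lemma E_ideal:
  assumes "f \<in> E" "0 \<le> g" "g \<le> f"
  shows "g \<in> E"
proof -
  have "0 \<in> below g" using assms subspace_E by (simp add: below_def subspace_0)
  moreover have "isUb E (below g) f"
    using assms by (auto simp: isUb_def setle_def below_def)
  moreover have "below g \<subseteq> E" by (auto simp: below_def)
  ultimately obtain s where s: "isLub E (below g) s"
    using dedekind_complete unfolding dedekind_complete_on_def by blast
  have sE: "s \<in> E" and s_ub: "\<And>x. x \<in> below g \<Longrightarrow> x \<le> s"
    and s_le: "\<And>b. b \<in> E \<Longrightarrow> (\<And>x. x \<in> below g \<Longrightarrow> x \<le> b) \<Longrightarrow> s \<le> b"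
    using s by (auto simp: isLub_def leastP_def isUb_def setle_def setge_def)
  have "g \<le> s" using isLub_below[OF assms(2)] s_ub unfolding isLub_UNIV_iff by blast
  have "g = s"
  proof (rule ccontr)
    assume "g \<noteq> s"
    then have "0 < s - g" using \<open>g \<le> s\<close> by simp
    then obtain x where x: "x \<in> E" "0 < x" "x \<le> s - g"
      using universal_completion unfolding universal_completion_of_def order_dense_def by blast
    have "s \<le> s - x"
    proof (rule s_le)
      show "s - x \<in> E" using sE x subspace_E by (simp add: subspace_diff)
      show "y \<le> s - x" if "y \<in> below g" for y
      proof -
        have "y \<le> g" using that by (simp add: below_def)
        also have "g \<le> s - x" using x(3) by (simp add: algebra_simps)
        finally show ?thesis .
      qed
    qed
    then show False using x(2) by simp
  qed
  then show ?thesis using sE by simp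
qed

lemma inf_in_E: "x \<in> E \<Longrightarrow> 0 \<le> x \<Longrightarrow> 0 \<le> y \<Longrightarrow> inf x y \<in> E"
  using E_ideal by simp

lemma up_directed_below: "0 \<le> f \<Longrightarrow> up_directed (below f)"
  unfolding up_directed_def
proof (intro conjI ballI)
  assume "0 \<le> f"
  then show "below f \<noteq> {}" using subspace_E subspace_0 unfolding below_def by blast
  fix x y assume "x \<in> below f" "y \<in> below f"
  then show "\<exists>z\<in>below f. x \<le> z \<and> y \<le> z"
    by (intro bexI[of _ "sup x y"]) (auto simp: below_def sup_in_E le_supI1)
qed

section \<open>Order continuity of \<open>T\<close> on \<open>E\<close>\<close>

lemma T_in_E: "x \<in> E \<Longrightarrow> T x \<in> E"
  and T_add: "x \<in> E \<Longrightarrow> y \<in> E \<Longrightarrow> T (x + y) = T x + T y"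
  and T_scaleR: "x \<in> E \<Longrightarrow> T (c *\<^sub>R x) = c *\<^sub>R T x"
  and T_nonneg: "x \<in> E \<Longrightarrow> 0 \<le> x \<Longrightarrow> 0 \<le> T x"
  and T_idem: "x \<in> E \<Longrightarrow> T (T x) = T x"
  using cond_exp
  by (auto simp: conditional_expectation_on_def linear_operator_on_def positive_on_def)

lemma T_diff: "x \<in> E \<Longrightarrow> y \<in> E \<Longrightarrow> T (x - y) = T x - T y"
  using T_add[of "x - y" y] subspace_E by (simp add: subspace_diff)

lemma T_mono: "x \<in> E \<Longrightarrow> y \<in> E \<Longrightarrow> x \<le> y \<Longrightarrow> T x \<le> T y"
  using T_nonneg[of "y - x"] T_diff[of y x] subspace_E by (simp add: subspace_diff)

text \<open>Order continuity speaks of sets decreasing to 0, with infima relative to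
  \<open>E\<close>; reflection at \<open>g\<close> turns \<open>D\<close> into such a set. The
  remaining work is to admit upper bounds outside \<open>E\<close>.\<close>

lemma isLub_T:
  assumes D: "D \<subseteq> E" "up_directed D" and lub: "isLub UNIV D g" and g: "g \<in> E"
  shows "isLub UNIV (T ` D) (T g)"
proof -
  have le: "d \<le> g" if "d \<in> D" for d using lub that by (simp add: isLub_UNIV_iff)
  define D' where "D' = (\<lambda>d. g - d) ` D"
  have "D' \<subseteq> E" using D g subspace_E by (auto simp: D'_def subspace_diff)
  moreover have "down_directed D'"
    unfolding down_directed_def
  proof (intro conjI ballI)
    show "D' \<noteq> {}" using D(2) by (simp add: D'_def up_directed_def)
    fix x y assume "x \<in> D'" "y \<in> D'"
    then obtain c d where cd: "c \<in> D" "d \<in> D" "x = g - c" "y = g - d" by (auto simp: D'_def)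
    then obtain z where "z \<in> D" "c \<le> z" "d \<le> z" using D(2) unfolding up_directed_def by meson
    then show "\<exists>z\<in>D'. z \<le> x \<and> z \<le> y"
      using cd by (intro bexI[of _ "g - z"]) (auto simp: D'_def diff_left_mono)
  qed
  moreover have "isGlb E D' 0"
  proof -
    have "l \<le> 0" if "\<And>d. d \<in> D \<Longrightarrow> l \<le> g - d" for l
    proof -
      have "d \<le> g - l" if "d \<in> D" for d
        using \<open>\<And>d. d \<in> D \<Longrightarrow> l \<le> g - d\<close>[OF that] by (simp add: algebra_simps)
      then have "g \<le> g - l" using lub unfolding isLub_UNIV_iff by blast
      then show ?thesis by simp
    qed
    then show ?thesis using le subspace_E
      by (auto simp: isGlb_def greatestP_def isLb_def setle_def setge_def D'_def subspace_0)
  qed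
  ultimately have "isGlb E (T ` D') 0"
    using cond_exp by (simp add: conditional_expectation_on_def order_continuous_on_def)
  then have glb: "l \<le> 0" if "l \<in> E" "\<And>d. d \<in> D \<Longrightarrow> l \<le> T (g - d)" for l
    using that by (auto simp: isGlb_def greatestP_def isLb_def setle_def setge_def D'_def)
  have Tle: "T d \<le> T g" if "d \<in> D" for d using that D g le by (intro T_mono) auto
  have "T g \<le> b" if b: "\<And>d. d \<in> D \<Longrightarrow> T d \<le> b" for b
  proof -
    obtain d0 where d0: "d0 \<in> D" using D(2) by (auto simp: up_directed_def)
    \<comment> \<open>Although \<open>b\<close> need not lie in \<open>E\<close>, this gap is
      squeezed between 0 and \<open>T (g - d0)\<close>, so it lies in the ideal
      \<open>E\<close>.\<close>
    define l where "l = T g - inf b (T g)"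
    have l_le: "l \<le> T (g - d)" if "d \<in> D" for d
    proof -
      have "T d \<le> inf b (T g)" using b Tle that by simp
      moreover have "T (g - d) = T g - T d" using that D g by (intro T_diff) auto
      ultimately show ?thesis unfolding l_def by (simp only: diff_left_mono)
    qed
    have "0 \<le> l" unfolding l_def by (simp only: diff_ge_0_iff_ge inf_le2)
    moreover have "T (g - d0) \<in> E" using d0 D g subspace_E by (intro T_in_E) (auto simp: subspace_diff)
    ultimately have "l \<in> E" using l_le[OF d0] E_ideal by blast
    then have "l \<le> 0" using glb l_le by blast
    then have "T g \<le> inf b (T g)" unfolding l_def by (simp only: diff_le_0_iff_le)
    then show ?thesis by simp
  qed
  then show ?thesis using Tle by (auto simp: isLub_UNIV_iff)
qed

text \<open>\<open>g\<close> is the supremum of the elements \<open>inf g d\<close> of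
  \<open>E\<close>, so order continuity applies even if \<open>f\<close> is outside
  \<open>E\<close>. This makes the extension independent of the approximating net.\<close>

lemma T_le_if_increases_to:
  assumes "increases_to E D f" "\<And>d. d \<in> D \<Longrightarrow> T d \<le> b" "g \<in> below f"
  shows "T g \<le> b"
proof -
  have D: "D \<subseteq> E" "\<And>d. d \<in> D \<Longrightarrow> 0 \<le> d" "up_directed D" "isLub UNIV D f"
    using assms(1) by (auto simp: increases_to_def)
  have g: "g \<in> E" "0 \<le> g" "g \<le> f" using assms(3) by (auto simp: below_def)
  have "inf g ` D \<subseteq> E" using g D by (auto intro: inf_in_E)
  then have "isLub UNIV (T ` inf g ` D) (T g)"
    using isLub_T up_directed_inf_left[OF D(3)] isLub_inf_left[OF D(4) g(3)] g(1) by blast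
  moreover have "T (inf g d) \<le> b" if "d \<in> D" for d
  proof -
    have "T (inf g d) \<le> T d" using g D that by (intro T_mono inf_in_E) auto
    then show ?thesis using assms(2)[OF that] by simp
  qed
  ultimately show ?thesis by (auto simp: isLub_UNIV_iff)
qed

section \<open>The extension on the positive cone\<close>

abbreviation domain_pos :: "'u set" where
  "domain_pos \<equiv> natural_domain_pos E T"

text \<open>Using the largest approximating set avoids choosing nets; \<open>extends_pos_iff\<close>
  identifies the result with the value along any net.\<close>

definition tau :: "'u \<Rightarrow> 'u" where
  "tau f = Sup (T ` below f)"

lemma increases_to_below: "0 \<le> f \<Longrightarrow> increases_to E (below f) f"
  using up_directed_below isLub_below by (auto simp: increases_to_def below_def)

lemma domain_pos_nonneg: "f \<in> domain_pos \<Longrightarrow> 0 \<le> f"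
  by (simp add: natural_domain_pos_def)

lemma domain_posI:
  assumes "0 \<le> f" "\<And>x. x \<in> below f \<Longrightarrow> T x \<le> b"
  shows "f \<in> domain_pos"
  using assms increases_to_below unfolding natural_domain_pos_def
  by (auto intro!: exI[of _ "below f"] bdd_aboveI[of _ b])

lemma isLub_tau:
  assumes "f \<in> domain_pos"
  shows "isLub UNIV (T ` below f) (tau f)"
proof -
  obtain D where D: "increases_to E D f" "bdd_above (T ` D)"
    using assms by (auto simp: natural_domain_pos_def)
  then obtain b where "\<And>d. d \<in> D \<Longrightarrow> T d \<le> b" by (auto simp: bdd_above_def)
  then have "T g \<le> b" if "g \<in> below f" for g using T_le_if_increases_to D(1) that by blast
  then have "bdd_above (T ` below f)" by (auto intro!: bdd_aboveI[of _ b])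
  moreover have "below f \<noteq> {}"
    using up_directed_below[OF domain_pos_nonneg[OF assms]] by (simp add: up_directed_def)
  ultimately show ?thesis unfolding tau_def by (intro isLub_Sup) auto
qed

lemma T_le_tau: "f \<in> domain_pos \<Longrightarrow> x \<in> below f \<Longrightarrow> T x \<le> tau f"
  using isLub_tau by (simp add: isLub_UNIV_iff)

lemma tau_le: "f \<in> domain_pos \<Longrightarrow> (\<And>x. x \<in> below f \<Longrightarrow> T x \<le> b) \<Longrightarrow> tau f \<le> b"
  using isLub_tau by (simp add: isLub_UNIV_iff)

text \<open>Every approximating set lies in \<open>below f\<close>, which gives one inequality;
  \<open>T_le_if_increases_to\<close> gives the other.\<close>

lemma extends_pos_iff:
  assumes "f \<in> domain_pos"
  shows "extends_pos E T f s \<longleftrightarrow> s = tau f"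
proof
  assume "extends_pos E T f s"
  then obtain D where D: "increases_to E D f" "isLub UNIV (T ` D) s" by (auto simp: extends_pos_def)
  have "D \<subseteq> below f" using D(1) by (auto simp: increases_to_def below_def isLub_UNIV_iff)
  then have "s \<le> tau f" using D(2) T_le_tau[OF assms] unfolding isLub_UNIV_iff by blast
  moreover have "tau f \<le> s"
  proof (rule tau_le[OF assms])
    show "T x \<le> s" if "x \<in> below f" for x
      using T_le_if_increases_to[OF D(1) _ that, of s] D(2) by (auto simp: isLub_UNIV_iff)
  qed
  ultimately show "s = tau f" by simp
next
  assume "s = tau f"
  then show "extends_pos E T f s"
    using isLub_tau[OF assms] increases_to_below[OF domain_pos_nonneg[OF assms]]
    by (auto simp: extends_pos_def)
qed

lemma domain_pos_mono:
  assumes "f \<in> domain_pos" "0 \<le> g" "g \<le> f"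
  shows "g \<in> domain_pos"
proof (rule domain_posI[OF assms(2)])
  show "T x \<le> tau f" if "x \<in> below g" for x
    using that assms(3) by (intro T_le_tau[OF assms(1)]) (auto simp: below_def)
qed

lemma tau_mono:
  assumes "f \<in> domain_pos" "0 \<le> g" "g \<le> f"
  shows "tau g \<le> tau f"
  using assms by (intro tau_le[OF domain_pos_mono] T_le_tau) (auto simp: below_def)

lemma tau_nonneg: "f \<in> domain_pos \<Longrightarrow> 0 \<le> tau f"
  using T_le_tau[of f 0] domain_pos_nonneg[of f] subspace_E T_diff[of 0 0]
  by (simp add: below_def subspace_0)

lemma
  assumes f: "f \<in> domain_pos" and g: "g \<in> domain_pos"
  shows domain_pos_add: "f + g \<in> domain_pos" and tau_add: "tau (f + g) = tau f + tau g"
proof -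
  have f0: "0 \<le> f" and g0: "0 \<le> g" using f g by (simp_all add: domain_pos_nonneg)
  have le: "T x \<le> tau f + tau g" if "x \<in> below (f + g)" for x
  proof -
    have x: "x \<in> E" "0 \<le> x" "x \<le> f + g" using that by (auto simp: below_def)
    \<comment> \<open>Riesz decomposition: \<open>x - y\<close> is the positive part of
      \<open>x - f\<close>, hence below \<open>g\<close>, and both pieces lie in \<open>E\<close>,
      where \<open>T\<close> is additive.\<close>
    define y where "y = inf x f"
    have y: "y \<in> below f" using x f0 by (simp add: y_def below_def inf_in_E)
    have yE: "y \<in> E" using y by (simp add: below_def)
    have "x - y = pprt (x - f)" by (simp only: y_def diff_inf_eq_pprt)
    also have "\<dots> \<le> g" using x(3) g0 by (simp add: pprt_def algebra_simps)
    finally have "x - y \<in> below g"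
      using x yE subspace_E by (simp add: below_def subspace_diff) (simp add: y_def)
    then have "T (x - y) \<le> tau g" using g by (rule T_le_tau[rotated])
    moreover have "T y \<le> tau f" using f y by (rule T_le_tau)
    moreover have "T x = T y + T (x - y)" using x(1) yE by (simp add: T_diff)
    ultimately show ?thesis by (simp add: add_mono)
  qed
  then show fg: "f + g \<in> domain_pos" using f0 g0 by (intro domain_posI) auto
  show "tau (f + g) = tau f + tau g"
  proof (rule order.antisym)
    show "tau (f + g) \<le> tau f + tau g" using le by (rule tau_le[OF fg])
    have "tau f \<le> tau (f + g) - tau g"
    proof (rule tau_le[OF f])
      fix x assume x: "x \<in> below f"
      have "tau g \<le> tau (f + g) - T x"
      proof (rule tau_le[OF g])
        fix y assume y: "y \<in> below g"
        have "T (x + y) \<le> tau (f + g)"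
          using x y subspace_E by (intro T_le_tau[OF fg]) (auto simp: below_def subspace_add add_mono)
        then show "T y \<le> tau (f + g) - T x"
          using x y by (simp add: below_def T_add algebra_simps)
      qed
      then show "T x \<le> tau (f + g) - tau g" by (simp add: algebra_simps)
    qed
    then show "tau f + tau g \<le> tau (f + g)" by (simp add: algebra_simps)
  qed
qed

text \<open>Monotone convergence: \<open>g\<close> in \<open>below f\<close> is the supremum of the
  \<open>inf g d\<close>, which lie in \<open>E\<close> and satisfy
  \<open>T (inf g d) \<le> tau d\<close>, so bounds of \<open>tau\<close> on \<open>D\<close> also
  bound \<open>T g\<close>.\<close>

lemma
  assumes D: "D \<subseteq> domain_pos" "up_directed D" and lub: "isLub UNIV D f"
    and b: "\<And>d. d \<in> D \<Longrightarrow> tau d \<le> b"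
  shows domain_pos_lub: "f \<in> domain_pos" and isLub_tau_image: "isLub UNIV (tau ` D) (tau f)"
proof -
  have le: "d \<le> f" if "d \<in> D" for d using lub that by (simp add: isLub_UNIV_iff)
  have D0: "0 \<le> d" if "d \<in> D" for d using that D(1) domain_pos_nonneg by blast
  obtain d0 where "d0 \<in> D" using D(2) by (auto simp: up_directed_def)
  then have f0: "0 \<le> f" using le D0 order_trans by blast
  have T_le: "T g \<le> c" if g: "g \<in> below f" and c: "\<And>d. d \<in> D \<Longrightarrow> tau d \<le> c" for g c
  proof -
    have g': "g \<in> E" "0 \<le> g" "g \<le> f" using g by (auto simp: below_def)
    have "inf g ` D \<subseteq> E" using g' D0 by (auto intro: inf_in_E)
    then have "isLub UNIV (T ` inf g ` D) (T g)"
      using isLub_T up_directed_inf_left[OF D(2)] isLub_inf_left[OF lub g'(3)] g'(1) by blast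
    moreover have "T (inf g d) \<le> c" if "d \<in> D" for d
    proof -
      have "T (inf g d) \<le> tau d"
        using that D(1) D0 g' by (intro T_le_tau) (auto simp: below_def inf_in_E)
      then show ?thesis using c[OF that] by simp
    qed
    ultimately show ?thesis by (auto simp: isLub_UNIV_iff)
  qed
  show fd: "f \<in> domain_pos" using T_le b by (intro domain_posI[OF f0]) blast
  have "tau d \<le> tau f" if "d \<in> D" for d using that le D0 by (intro tau_mono[OF fd])
  moreover have "tau f \<le> c" if "\<And>d. d \<in> D \<Longrightarrow> tau d \<le> c" for c
    using T_le that by (intro tau_le[OF fd]) blast
  ultimately show "isLub UNIV (tau ` D) (tau f)" by (auto simp: isLub_UNIV_iff)
qed

lemma
  assumes "x \<in> E" "0 \<le> x"
  shows E_domain_pos: "x \<in> domain_pos" and tau_eq_T: "tau x = T x"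
proof -
  have le: "T y \<le> T x" if "y \<in> below x" for y
    using that assms by (intro T_mono) (auto simp: below_def)
  then show x: "x \<in> domain_pos" using assms by (intro domain_posI) auto
  have "T x \<le> tau x" using assms by (intro T_le_tau[OF x]) (auto simp: below_def)
  then show "tau x = T x" using tau_le[OF x le] by simp
qed

lemma tau_0 [simp]: "tau 0 = 0"
  using tau_eq_T[of 0] T_diff[of 0 0] subspace_E by (simp add: subspace_0)

lemma zero_domain_pos [simp]: "0 \<in> domain_pos"
  using E_domain_pos[of 0] subspace_E by (simp add: subspace_0)

lemma
  assumes f: "f \<in> domain_pos" and c: "0 \<le> c"
  shows domain_pos_scaleR: "c *\<^sub>R f \<in> domain_pos" and tau_scaleR: "tau (c *\<^sub>R f) = c *\<^sub>R tau f"
proof -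
  have f0: "0 \<le> f" using f by (rule domain_pos_nonneg)
  have le: "c *\<^sub>R g \<in> domain_pos \<and> tau (c *\<^sub>R g) \<le> c *\<^sub>R tau g"
    if "0 < c" "g \<in> domain_pos" for c g
  proof -
    have T_le: "T x \<le> c *\<^sub>R tau g" if x: "x \<in> below (c *\<^sub>R g)" for x
    proof -
      have "x /\<^sub>R c \<in> below g"
        using x \<open>0 < c\<close> subspace_E
        by (auto simp: below_def subspace_scale scaleR_nonneg_nonneg pos_divideR_le_eq)
      then have "T (x /\<^sub>R c) \<le> tau g" by (rule T_le_tau[OF \<open>g \<in> domain_pos\<close>])
      then have "T x /\<^sub>R c \<le> tau g" using x by (simp add: below_def T_scaleR)
      then show ?thesis using \<open>0 < c\<close> by (simp add: pos_divideR_le_eq)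
    qed
    have "c *\<^sub>R g \<in> domain_pos"
      using T_le that domain_pos_nonneg by (intro domain_posI) (auto simp: scaleR_nonneg_nonneg)
    then show ?thesis using T_le tau_le by blast
  qed
  have "c *\<^sub>R f \<in> domain_pos \<and> tau (c *\<^sub>R f) = c *\<^sub>R tau f"
  proof (cases "c = 0")
    case True
    then show ?thesis by simp
  next
    case False
    then have c: "0 < c" using c by simp
    \<comment> \<open>The reverse inequality is the one already proved, for the factor
      \<open>inverse c\<close> and the element \<open>c f\<close>.\<close>
    have "tau (inverse c *\<^sub>R (c *\<^sub>R f)) \<le> inverse c *\<^sub>R tau (c *\<^sub>R f)"
      using le[of c f] le[of "inverse c" "c *\<^sub>R f"] c f by simp
    then have "tau f \<le> tau (c *\<^sub>R f) /\<^sub>R c" using False by simp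
    then have "c *\<^sub>R tau f \<le> tau (c *\<^sub>R f)" using c by (simp add: pos_le_divideR_eq)
    then show ?thesis using le[OF c f] by (simp add: order.antisym)
  qed
  then show "c *\<^sub>R f \<in> domain_pos" "tau (c *\<^sub>R f) = c *\<^sub>R tau f" by blast+
qed

lemma tau_eq_0_imp:
  assumes "f \<in> domain_pos" "tau f = 0"
  shows "f = 0"
proof -
  have "x = 0" if "x \<in> below f" for x
  proof -
    have "T x \<le> 0" using T_le_tau[OF assms(1) that] assms(2) by simp
    moreover have x: "x \<in> E" "0 \<le> x" using that by (auto simp: below_def)
    ultimately have "T x = 0" using T_nonneg by (simp add: order.antisym)
    then show ?thesis using x strictly_positive by (auto simp: strictly_positive_on_def)
  qed
  then have "f \<le> 0"
    using isLub_below[OF domain_pos_nonneg[OF assms(1)]] unfolding isLub_UNIV_iff by (metis order_refl)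
  then show ?thesis using domain_pos_nonneg[OF assms(1)] by simp
qed

text \<open>\<open>tau f\<close> is the supremum of a directed set of elements of \<open>E\<close>
  fixed by \<open>T\<close>, to which monotone convergence applies.\<close>

lemma
  assumes f: "f \<in> domain_pos"
  shows tau_in_domain_pos: "tau f \<in> domain_pos" and tau_idem: "tau (tau f) = tau f"
proof -
  define D where "D = T ` below f"
  have DE: "x \<in> E \<and> 0 \<le> x \<and> T x = x" if "x \<in> D" for x
    using that by (auto simp: D_def below_def T_in_E T_nonneg T_idem)
  then have tau_D: "tau x = x" if "x \<in> D" for x using that tau_eq_T by simp
  have "D \<subseteq> domain_pos" using DE E_domain_pos by blast
  moreover have "up_directed D"
    unfolding D_def
    by (rule up_directed_image_mono[OF up_directed_below[OF domain_pos_nonneg[OF f]]])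
      (auto simp: below_def intro: T_mono)
  moreover have lub: "isLub UNIV D (tau f)" unfolding D_def by (rule isLub_tau[OF f])
  moreover have "tau x \<le> tau f" if "x \<in> D" for x
    using that tau_D lub by (simp add: isLub_UNIV_iff)
  ultimately have *: "tau f \<in> domain_pos" "isLub UNIV (tau ` D) (tau (tau f))"
    using domain_pos_lub isLub_tau_image by blast+
  show "tau f \<in> domain_pos" by (rule *)
  have "tau ` D = D" using tau_D by simp
  with *(2) have "isLub UNIV D (tau (tau f))" by simp
  then show "tau (tau f) = tau f" by (rule isLub_UNIV_unique[OF _ lub])
qed

section \<open>From the positive cone to the natural domain\<close>

abbreviation L1T :: "'u set" where "L1T \<equiv> L1 E T"
abbreviation TT :: "'u \<Rightarrow> 'u" where "TT \<equiv> extT E T"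
abbreviation A :: "'u set" where "A \<equiv> rangeT E T"

lemma L1_diffI: "f \<in> domain_pos \<Longrightarrow> g \<in> domain_pos \<Longrightarrow> f - g \<in> L1T"
  by (auto simp: L1_def)

text \<open>Two representations of one element satisfy \<open>f + f2 = f1 + g\<close>, so additivity
  on the cone makes the described value unique.\<close>

lemma extT_diff_eq:
  assumes "f \<in> domain_pos" "g \<in> domain_pos"
  shows "TT (f - g) = tau f - tau g"
  unfolding extT_def
proof (rule the_equality)
  show "\<exists>f1 f2 s1 s2. f1 \<in> domain_pos \<and> f2 \<in> domain_pos \<and> f - g = f1 - f2 \<and>
      extends_pos E T f1 s1 \<and> extends_pos E T f2 s2 \<and> tau f - tau g = s1 - s2"
    using assms by (intro exI[of _ f] exI[of _ g] exI[of _ "tau f"] exI[of _ "tau g"])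
      (simp add: extends_pos_iff)
next
  fix t
  assume "\<exists>f1 f2 s1 s2. f1 \<in> domain_pos \<and> f2 \<in> domain_pos \<and> f - g = f1 - f2 \<and>
      extends_pos E T f1 s1 \<and> extends_pos E T f2 s2 \<and> t = s1 - s2"
  then obtain f1 f2 where *: "f1 \<in> domain_pos" "f2 \<in> domain_pos" "f - g = f1 - f2"
    "t = tau f1 - tau f2"
    by (auto simp: extends_pos_iff)
  then have "f + f2 = f1 + g" by (simp add: algebra_simps)
  then have "tau f + tau f2 = tau f1 + tau g"
    using tau_add[of f f2] tau_add[of f1 g] * assms by simp
  then have "tau f1 = tau f + tau f2 - tau g" by (simp add: eq_diff_eq)
  then show "t = tau f - tau g" using * by simp
qed

lemma extT_eq_tau: "f \<in> domain_pos \<Longrightarrow> TT f = tau f"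
  using extT_diff_eq[of f 0] by simp

lemma L1E:
  assumes "f \<in> L1T"
  obtains f1 f2 where "f1 \<in> domain_pos" "f2 \<in> domain_pos" "f = f1 - f2" "TT f = tau f1 - tau f2"
proof -
  obtain f1 f2 where "f1 \<in> domain_pos" "f2 \<in> domain_pos" "f = f1 - f2"
    using assms by (auto simp: L1_def)
  then show thesis using that extT_diff_eq by simp
qed

text \<open>Membership is reduced to the cone, which is closed under passing to smaller positive
  elements; solidity of the domain follows.\<close>

lemma L1_iff_abs: "f \<in> L1T \<longleftrightarrow> \<bar>f\<bar> \<in> domain_pos"
proof
  assume "f \<in> L1T"
  then obtain f1 f2 where f: "f1 \<in> domain_pos" "f2 \<in> domain_pos" "f = f1 - f2" by (rule L1E)
  have "\<bar>f\<bar> \<le> f1 + f2"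
    using abs_triangle_ineq4[of f1 f2] domain_pos_nonneg[OF f(1)] domain_pos_nonneg[OF f(2)] f(3)
    by simp
  then show "\<bar>f\<bar> \<in> domain_pos" by (rule domain_pos_mono[OF domain_pos_add[OF f(1,2)], rotated]) simp
next
  assume abs: "\<bar>f\<bar> \<in> domain_pos"
  have "pprt f \<in> domain_pos" "- nprt f \<in> domain_pos"
    using domain_pos_mono[OF abs] by (simp_all add: abs_prts)
  then have "pprt f - (- nprt f) \<in> L1T" by (rule L1_diffI)
  then show "f \<in> L1T" using prts[of f] by simp
qed

lemma domain_pos_iff: "f \<in> domain_pos \<longleftrightarrow> f \<in> L1T \<and> 0 \<le> f"
  using L1_iff_abs[of f] domain_pos_nonneg[of f] by auto

lemma L1_solid: "g \<in> L1T \<Longrightarrow> \<bar>f\<bar> \<le> \<bar>g\<bar> \<Longrightarrow> f \<in> L1T"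
  using domain_pos_mono[of "\<bar>g\<bar>" "\<bar>f\<bar>"] by (simp add: L1_iff_abs)

lemma
  assumes "f \<in> L1T" "g \<in> L1T"
  shows L1_add: "f + g \<in> L1T" and extT_add: "TT (f + g) = TT f + TT g"
proof -
  obtain f1 f2 where f: "f1 \<in> domain_pos" "f2 \<in> domain_pos" "f = f1 - f2" "TT f = tau f1 - tau f2"
    using assms(1) by (rule L1E)
  obtain g1 g2 where g: "g1 \<in> domain_pos" "g2 \<in> domain_pos" "g = g1 - g2" "TT g = tau g1 - tau g2"
    using assms(2) by (rule L1E)
  have *: "f + g = (f1 + g1) - (f2 + g2)" using f g by simp
  show "f + g \<in> L1T" unfolding * using f g by (intro L1_diffI domain_pos_add)
  show "TT (f + g) = TT f + TT g"
    unfolding * using f g by (simp add: extT_diff_eq domain_pos_add tau_add)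
qed

lemma
  assumes "f \<in> L1T"
  shows L1_uminus: "- f \<in> L1T" and extT_uminus: "TT (- f) = - TT f"
proof -
  obtain f1 f2 where f: "f1 \<in> domain_pos" "f2 \<in> domain_pos" "f = f1 - f2" "TT f = tau f1 - tau f2"
    using assms(1) by (rule L1E)
  have *: "- f = f2 - f1" using f by simp
  show "- f \<in> L1T" unfolding * using f by (intro L1_diffI)
  show "TT (- f) = - TT f" unfolding * using f by (simp add: extT_diff_eq)
qed

lemma L1_diff: "f \<in> L1T \<Longrightarrow> g \<in> L1T \<Longrightarrow> f - g \<in> L1T"
  and extT_diff: "f \<in> L1T \<Longrightarrow> g \<in> L1T \<Longrightarrow> TT (f - g) = TT f - TT g"
  using L1_add[of f "- g"] extT_add[of f "- g"] by (simp_all add: L1_uminus extT_uminus)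

lemma
  assumes "f \<in> L1T"
  shows L1_scaleR: "c *\<^sub>R f \<in> L1T" and extT_scaleR: "TT (c *\<^sub>R f) = c *\<^sub>R TT f"
proof -
  have *: "c *\<^sub>R f \<in> L1T \<and> TT (c *\<^sub>R f) = c *\<^sub>R TT f" if c: "0 \<le> c" and f: "f \<in> L1T" for c f
  proof -
    obtain f1 f2 where f: "f1 \<in> domain_pos" "f2 \<in> domain_pos" "f = f1 - f2" "TT f = tau f1 - tau f2"
      using \<open>f \<in> L1T\<close> by (rule L1E)
    have "c *\<^sub>R f = c *\<^sub>R f1 - c *\<^sub>R f2" using f(3) by (simp add: scaleR_diff_right)
    then show ?thesis
      using f c by (simp add: L1_diffI extT_diff_eq domain_pos_scaleR tau_scaleR scaleR_diff_right)
  qed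
  have "c *\<^sub>R f \<in> L1T \<and> TT (c *\<^sub>R f) = c *\<^sub>R TT f"
  proof (cases "0 \<le> c")
    case True
    then show ?thesis using * assms by blast
  next
    case False
    then show ?thesis
      using *[of "- c" "- f"] assms by (simp add: L1_uminus extT_uminus)
  qed
  then show "c *\<^sub>R f \<in> L1T" "TT (c *\<^sub>R f) = c *\<^sub>R TT f" by blast+
qed

lemma zero_L1 [simp]: "0 \<in> L1T" and extT_0 [simp]: "TT 0 = 0"
  using extT_eq_tau[of 0] domain_pos_iff[of 0] by simp_all

lemma extT_nonneg: "f \<in> L1T \<Longrightarrow> 0 \<le> f \<Longrightarrow> 0 \<le> TT f"
  using tau_nonneg[of f] extT_eq_tau[of f] domain_pos_iff[of f] by simp

lemma extT_mono: "f \<in> L1T \<Longrightarrow> g \<in> L1T \<Longrightarrow> f \<le> g \<Longrightarrow> TT f \<le> TT g"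
  using extT_nonneg[of "g - f"] by (simp add: L1_diff extT_diff)

lemma extT_eq_0_imp: "f \<in> L1T \<Longrightarrow> 0 \<le> f \<Longrightarrow> TT f = 0 \<Longrightarrow> f = 0"
  using tau_eq_0_imp[of f] extT_eq_tau[of f] domain_pos_iff[of f] by simp

section \<open>The range \<open>A\<close> as an order closed Riesz subspace\<close>

lemma rangeT_iff: "a \<in> A \<longleftrightarrow> a \<in> L1T \<and> TT a = a"
proof
  assume "a \<in> A"
  then obtain f where f: "f \<in> L1T" "a = TT f" by (auto simp: rangeT_def)
  obtain f1 f2 where f12: "f1 \<in> domain_pos" "f2 \<in> domain_pos" "TT f = tau f1 - tau f2"
    using f(1) by (rule L1E)
  then show "a \<in> L1T \<and> TT a = a"
    using f(2) by (simp add: L1_diffI extT_diff_eq tau_in_domain_pos tau_idem)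
next
  assume "a \<in> L1T \<and> TT a = a"
  then show "a \<in> A" unfolding rangeT_def by (metis imageI)
qed

text \<open>\<open>T\<bar>a\<bar> - \<bar>a\<bar> \<ge> 0\<close> by positivity and it is annihilated by \<open>T\<close>, so strict positivity makes
  it vanish.\<close>

lemma rangeT_abs:
  assumes "a \<in> A"
  shows "\<bar>a\<bar> \<in> A"
proof -
  have a: "a \<in> L1T" "TT a = a" using assms by (simp_all add: rangeT_iff)
  have abs: "\<bar>a\<bar> \<in> L1T" using a(1) by (rule L1_solid) simp
  note extT_mono[OF a(1) abs abs_ge_self] extT_mono[OF L1_uminus[OF a(1)] abs abs_ge_minus_self]
  then have le: "\<bar>a\<bar> \<le> TT \<bar>a\<bar>" using a by (intro abs_leI) (simp_all add: extT_uminus)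
  have "TT \<bar>a\<bar> \<in> A" using abs by (simp add: rangeT_def)
  then have T: "TT \<bar>a\<bar> \<in> L1T" "TT (TT \<bar>a\<bar>) = TT \<bar>a\<bar>" by (simp_all add: rangeT_iff)
  have "TT \<bar>a\<bar> - \<bar>a\<bar> = 0"
    by (rule extT_eq_0_imp) (use T abs le in \<open>simp_all add: L1_diff extT_diff\<close>)
  then show ?thesis using abs by (simp add: rangeT_iff)
qed

lemma subspace_rangeT: "subspace A"
  by (auto simp: subspace_def rangeT_iff L1_add L1_scaleR extT_add extT_scaleR)

lemma rangeT_pprt:
  assumes "a \<in> A"
  shows "pprt a \<in> A"
proof -
  have "a + \<bar>a\<bar> = (pprt a + nprt a) + (pprt a - nprt a)"
    by (simp only: prts[symmetric] abs_prts[symmetric])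
  then have "a + \<bar>a\<bar> = pprt a + pprt a" by simp
  then have "pprt a = (1 / 2) *\<^sub>R (a + \<bar>a\<bar>)" by (simp flip: scaleR_2)
  then show ?thesis
    using assms rangeT_abs subspace_rangeT by (simp add: subspace_add subspace_scale)
qed

lemma riesz_subspace_rangeT: "riesz_subspace A"
proof -
  have "sup x y \<in> A \<and> inf x y \<in> A" if "x \<in> A" "y \<in> A" for x y
  proof -
    have "x - inf x y = pprt (x - y)" by (rule diff_inf_eq_pprt)
    then have "inf x y = x - pprt (x - y)" by (simp only: algebra_simps)
    moreover have "pprt (x - y) \<in> A"
      using that subspace_rangeT by (intro rangeT_pprt) (simp add: subspace_diff)
    ultimately have "inf x y \<in> A" using that subspace_rangeT by (simp only: subspace_diff)
    moreover have "sup x y = x + y - inf x y" using add_eq_inf_sup[of x y] by (simp only: eq_diff_eq)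
    ultimately show ?thesis using that subspace_rangeT by (simp only: subspace_diff subspace_add)
  qed
  then show ?thesis using subspace_rangeT by (simp add: riesz_subspace_def)
qed

lemma rangeT_inf: "x \<in> A \<Longrightarrow> y \<in> A \<Longrightarrow> inf x y \<in> A"
  using riesz_subspace_rangeT by (simp add: riesz_subspace_def)

text \<open>Monotone convergence concerns positive elements, so \<open>D\<close> is cut down to its
  members above some \<open>d0\<close> and translated by \<open>- d0\<close>. Suprema are those of
  the whole type, as \<open>component_approximation\<close> and \<open>square_root_exists\<close>
  require.\<close>

lemma rangeT_lub:
  assumes D: "D \<subseteq> A" "up_directed D" and lub: "isLub UNIV D s"
  shows "s \<in> A"
proof -
  obtain d0 where d0: "d0 \<in> D" using D(2) by (auto simp: up_directed_def)
  define D' where "D' = {d \<in> D. d0 \<le> d}"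
  define F where "F = (\<lambda>d. d - d0) ` D'"
  have cofinal: "\<exists>d'\<in>D'. d \<le> d'" if "d \<in> D" for d
    using D(2) that d0 unfolding up_directed_def D'_def by blast
  have "isLub UNIV D' s"
  proof -
    have "s \<le> b" if "\<forall>x\<in>D'. x \<le> b" for b
    proof -
      have "\<forall>x\<in>D. x \<le> b" using that cofinal order_trans by blast
      then show ?thesis using lub by (simp add: isLub_UNIV_iff)
    qed
    then show ?thesis using lub by (simp add: isLub_UNIV_iff D'_def)
  qed
  then have lubF: "isLub UNIV F (s - d0)" unfolding F_def by (rule isLub_translate)
  have "up_directed D'"
    unfolding up_directed_def
  proof (intro conjI ballI)
    show "D' \<noteq> {}" using d0 by (auto simp: D'_def)
    fix x y assume xy: "x \<in> D'" "y \<in> D'"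
    then obtain z where "z \<in> D" "x \<le> z" "y \<le> z"
      using D(2) unfolding up_directed_def D'_def by blast
    then show "\<exists>z\<in>D'. x \<le> z \<and> y \<le> z" using xy unfolding D'_def by (auto intro: order_trans)
  qed
  then have dirF: "up_directed F"
    unfolding F_def by (rule up_directed_image_mono) (simp add: diff_right_mono)
  have F: "x \<in> A \<and> 0 \<le> x" if "x \<in> F" for x
    using that D(1) d0 subspace_rangeT by (auto simp: F_def D'_def intro!: subspace_diff)
  then have F': "x \<in> domain_pos" "tau x = x" if "x \<in> F" for x
    using that extT_eq_tau[of x] by (auto simp: domain_pos_iff rangeT_iff)
  have "tau x \<le> s - d0" if "x \<in> F" for x
    using F'[OF that] lubF that by (simp add: isLub_UNIV_iff)
  then have s: "s - d0 \<in> domain_pos" "isLub UNIV (tau ` F) (tau (s - d0))"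
    using domain_pos_lub[OF _ dirF lubF] isLub_tau_image[OF _ dirF lubF] F' by blast+
  have "tau ` F = F" using F' by simp
  then have "tau (s - d0) = s - d0" using s(2) isLub_UNIV_unique lubF by metis
  then have "s - d0 \<in> A" using s(1) extT_eq_tau by (simp add: rangeT_iff domain_pos_iff)
  then have "(s - d0) + d0 \<in> A" using d0 D(1) subspace_rangeT by (intro subspace_add) auto
  then show ?thesis by simp
qed

lemma unit_in_rangeT: "e \<in> A"
  using unit_in_E E_domain_pos[of e] tau_eq_T[of e] extT_eq_tau[of e] T_unit
  by (simp add: rangeT_iff domain_pos_iff)

section \<open>The averaging identity\<close>

lemma isLub_mult_right:
  fixes c f :: 'u
  assumes "up_directed D" "isLub UNIV D f" "0 \<le> c"
  shows "isLub UNIV ((\<lambda>d. d * c) ` D) (f * c)"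
proof -
  have "(\<lambda>d. d * c) = (*) c" by (rule ext) (rule f_algebra_mult_commute)
  then show ?thesis using isLub_mult_left[OF assms] by (simp only: f_algebra_mult_commute[of f c])
qed

text \<open>Since \<open>p * trunc z n \<le> n p\<close> and \<open>tau p = p\<close>, the image of
  a truncated product is below \<open>n p\<close>, which \<open>e - p\<close> annihilates; monotone
  convergence then reaches \<open>p * z\<close>.\<close>

lemma tau_component_disjoint:
  assumes p: "p \<in> A" "0 \<le> p" "inf p (e - p) = 0" and z: "z \<in> domain_pos"
  shows "p * z \<in> domain_pos" and "(e - p) * tau (p * z) = 0"
proof -
  have z0: "0 \<le> z" using z by (rule domain_pos_nonneg)
  have pe: "0 \<le> e - p" using p(3) by (metis inf.cobounded2)
  then have "p \<le> e" by simp
  then have "p * z \<le> e * z" using z0 by (rule mult_right_mono)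
  then show pz: "p * z \<in> domain_pos"
    using p z z0 by (intro domain_pos_mono[OF z]) simp_all
  have pp: "p \<in> domain_pos" "tau p = p"
    using p extT_eq_tau[of p] by (auto simp: rangeT_iff domain_pos_iff)
  define D where "D = (*) p ` range (trunc z)"
  have lub: "isLub UNIV D (p * z)"
    unfolding D_def by (rule isLub_mult_left[OF up_directed_trunc isLub_trunc p(2)])
  have dir: "up_directed D"
    unfolding D_def by (rule up_directed_image_mono[OF up_directed_trunc])
      (simp add: mult_left_mono p(2))
  have D: "d \<in> domain_pos" if "d \<in> D" for d
    using that p z0 by (intro domain_pos_mono[OF pz])
      (auto simp: D_def trunc_nonneg trunc_le intro!: mult_left_mono)
  have "tau d \<le> tau (p * z)" if "d \<in> D" for d
    using D[OF that] lub that by (intro tau_mono[OF pz]) (auto simp: isLub_UNIV_iff domain_pos_nonneg)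
  then have "isLub UNIV (tau ` D) (tau (p * z))" using D by (intro isLub_tau_image[OF _ dir lub]) auto
  moreover have "up_directed (tau ` D)"
    using D by (intro up_directed_image_mono[OF dir] tau_mono) (auto simp: domain_pos_nonneg)
  ultimately have "isLub UNIV ((*) (e - p) ` tau ` D) ((e - p) * tau (p * z))"
    using pe by (intro isLub_mult_left)
  moreover have "(e - p) * tau d \<le> 0" if d: "d \<in> D" for d
  proof -
    obtain n where n: "d = p * trunc z n" using d by (auto simp: D_def)
    have "d \<le> p * (real n *\<^sub>R e)" unfolding n by (intro mult_left_mono trunc_le p)
    then have "d \<le> real n *\<^sub>R p" by simp
    then have "tau d \<le> real n *\<^sub>R p"
      using tau_mono[OF domain_pos_scaleR[OF pp(1)], of "real n" d] D[OF that] pp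
      by (simp add: domain_pos_nonneg tau_scaleR)
    then have "(e - p) * tau d \<le> (e - p) * (real n *\<^sub>R p)" using pe by (rule mult_left_mono)
    also have "(e - p) * (real n *\<^sub>R p) = 0"
      using disjoint_imp_mult_eq_0[of "e - p" p] p(3) by (simp add: inf_commute)
    finally show ?thesis .
  qed
  ultimately have "(e - p) * tau (p * z) \<le> 0" by (auto simp: isLub_UNIV_iff)
  moreover have "0 \<le> (e - p) * tau (p * z)" using pe tau_nonneg[OF pz] by simp
  ultimately show "(e - p) * tau (p * z) = 0" by (rule order.antisym)
qed

text \<open>The images of \<open>p z\<close> and \<open>(e - p) z\<close> are annihilated by
  \<open>e - p\<close> and \<open>p\<close> respectively, so multiplying \<open>tau z\<close> by
  \<open>p\<close> isolates the first.\<close>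

lemma tau_mult_component:
  assumes p: "p \<in> A" "0 \<le> p" "inf p (e - p) = 0" and z: "z \<in> domain_pos"
  shows "tau (p * z) = p * tau z"
proof -
  note 1 = tau_component_disjoint[OF p z]
  have "e - p \<in> A" using p unit_in_rangeT subspace_rangeT by (simp add: subspace_diff)
  moreover have "0 \<le> e - p" using p(3) by (metis inf.cobounded2)
  moreover have "inf (e - p) (e - (e - p)) = 0" using p(3) by (simp add: inf_commute)
  ultimately have 2: "(e - p) * z \<in> domain_pos" "p * tau ((e - p) * z) = 0"
    using tau_component_disjoint[of "e - p" z] z by simp_all
  have "tau z = tau (p * z + (e - p) * z)" by (simp add: algebra_simps)
  also have "\<dots> = tau (p * z) + tau ((e - p) * z)" by (rule tau_add[OF 1(1) 2(1)])
  finally have "p * tau z = p * tau (p * z)" using 2 by (simp add: distrib_left)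
  then show ?thesis using 1(2) by (simp add: algebra_simps)
qed

text \<open>Write \<open>n a = c + r\<close> with \<open>c\<close> a sum of components of
  \<open>e\<close>, where the identity is exact, and \<open>r\<close> in \<open>[0, e]\<close>. The
  remainders \<open>tau (r * z)\<close> and \<open>r * tau z\<close> both lie in
  \<open>[0, tau z]\<close>, a bound free of \<open>n\<close>.\<close>

lemma tau_mult_bounded:
  assumes a: "a \<in> A" "0 \<le> a" "a \<le> real k *\<^sub>R e" and z: "z \<in> domain_pos"
  shows "a * z \<in> domain_pos" and "tau (a * z) = a * tau z"
proof -
  have z0: "0 \<le> z" using z by (rule domain_pos_nonneg)
  have "a * z \<le> (real k *\<^sub>R e) * z" using a z0 by (intro mult_right_mono)
  then show az: "a * z \<in> domain_pos"
    using a z0 by (intro domain_pos_mono[OF domain_pos_scaleR[OF z, of "real k"]]) simp_all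
  have "real n *\<^sub>R (tau (a * z) - a * tau z) \<le> tau z \<and>
    real n *\<^sub>R (a * tau z - tau (a * z)) \<le> tau z" for n
  proof -
    \<comment> \<open>Domain membership is carried along because \<open>tau_add\<close> requires it
      at each added component.\<close>
    define C where "C c \<longleftrightarrow> c * z \<in> domain_pos \<and> tau (c * z) = c * tau z" for c
    have "real n *\<^sub>R a \<le> real n *\<^sub>R (real k *\<^sub>R e)" using a by (intro scaleR_left_mono) auto
    also have "\<dots> \<le> real (Suc (n * k)) *\<^sub>R e" by (simp add: algebra_simps)
    finally have bound: "real n *\<^sub>R a \<le> real (Suc (n * k)) *\<^sub>R e" .
    have na: "real n *\<^sub>R a \<in> A" "0 \<le> real n *\<^sub>R a"
      using a subspace_rangeT by (simp_all add: subspace_scale scaleR_nonneg_nonneg)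
    have C0: "C 0" by (simp add: C_def)
    have C_add: "C (p + c)" if "p \<in> A" "0 \<le> p" "inf p (e - p) = 0" "C c" for p c
      using that tau_component_disjoint(1)[OF that(1-3) z] tau_mult_component[OF that(1-3) z]
      by (simp add: C_def distrib_right domain_pos_add tau_add)
    have "\<exists>c r. real n *\<^sub>R a = c + r \<and> C c \<and> r \<in> A \<and> 0 \<le> r \<and> r \<le> e"
      by (rule component_approximation[where n = "n * k"])
        (fact riesz_subspace_rangeT unit_in_rangeT unit_nonneg na bound C0 rangeT_lub C_add)+
    then obtain c r where cr: "real n *\<^sub>R a = c + r" "C c" "0 \<le> r" "r \<le> e"
      by blast
    have "r * z \<le> e * z" using cr z0 by (intro mult_right_mono)
    then have rz: "r * z \<in> domain_pos" "tau (r * z) \<le> tau z"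
      using cr z0 domain_pos_mono[OF z, of "r * z"] tau_mono[OF z, of "r * z"] by simp_all
    have "r * tau z \<le> e * tau z" using cr tau_nonneg[OF z] by (intro mult_right_mono)
    then have rtz: "0 \<le> r * tau z" "r * tau z \<le> tau z" using cr tau_nonneg[OF z] by simp_all
    have "real n *\<^sub>R tau (a * z) = tau (real n *\<^sub>R (a * z))" using az by (simp add: tau_scaleR)
    also have "real n *\<^sub>R (a * z) = c * z + r * z"
      using arg_cong[OF cr(1), of "\<lambda>x. x * z"] by (simp add: distrib_right)
    also have "tau (c * z + r * z) = c * tau z + tau (r * z)"
      using cr(2) rz by (simp add: C_def tau_add)
    finally have 1: "real n *\<^sub>R tau (a * z) = c * tau z + tau (r * z)" .
    have 2: "real n *\<^sub>R (a * tau z) = c * tau z + r * tau z"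
      using arg_cong[OF cr(1), of "\<lambda>x. x * tau z"] by (simp add: distrib_right)
    have "tau (r * z) - r * tau z \<le> tau z" "r * tau z - tau (r * z) \<le> tau z"
      using rz(2) rtz tau_nonneg[OF rz(1)] by (simp_all only: diff_le_eq add_increasing2)
    then show ?thesis using 1 2 by (simp add: scaleR_diff_right)
  qed
  then show "tau (a * z) = a * tau z" using archimedean_eqI by blast
qed

text \<open>The natural domain asks only for a bound in the universal completion, and
  \<open>a * tau z\<close> is one for all truncations of \<open>a\<close>. Order continuity of
  multiplication then evaluates the limit.\<close>

lemma tau_mult:
  assumes a: "a \<in> A" "0 \<le> a" and z: "z \<in> domain_pos"
  shows "a * z \<in> domain_pos" and "tau (a * z) = a * tau z"
proof -
  have z0: "0 \<le> z" using z by (rule domain_pos_nonneg)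
  have trunc_A: "trunc a n \<in> A" for n
    using a unit_in_rangeT subspace_rangeT by (simp add: trunc_def rangeT_inf subspace_scale)
  note b = tau_mult_bounded[OF trunc_A trunc_nonneg[OF a(2)] trunc_le(2) z]
  define D where "D = (\<lambda>d. d * z) ` range (trunc a)"
  have lub: "isLub UNIV D (a * z)"
    unfolding D_def by (rule isLub_mult_right[OF up_directed_trunc isLub_trunc z0])
  have dir: "up_directed D"
    unfolding D_def by (rule up_directed_image_mono[OF up_directed_trunc])
      (simp add: mult_right_mono z0)
  have D: "D \<subseteq> domain_pos" using b(1) by (auto simp: D_def)
  have le: "tau d \<le> a * tau z" if "d \<in> D" for d
    using that b(2) tau_nonneg[OF z] by (auto simp: D_def trunc_le intro!: mult_right_mono)
  show "a * z \<in> domain_pos" by (rule domain_pos_lub[OF D dir lub le])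
  have lub_tau: "isLub UNIV (tau ` D) (tau (a * z))" by (rule isLub_tau_image[OF D dir lub le])
  have "tau ` D = (\<lambda>d. d * tau z) ` range (trunc a)"
    using b(2) by (simp add: D_def image_image)
  moreover have "isLub UNIV ((\<lambda>d. d * tau z) ` range (trunc a)) (a * tau z)"
    by (rule isLub_mult_right[OF up_directed_trunc isLub_trunc tau_nonneg[OF z]])
  ultimately have "isLub UNIV (tau ` D) (a * tau z)" by simp
  with lub_tau show "tau (a * z) = a * tau z" by (rule isLub_UNIV_unique)
qed

lemma
  assumes a: "a \<in> A" and z: "z \<in> L1T"
  shows L1_mult: "a * z \<in> L1T" and extT_mult: "TT (a * z) = a * TT z"
proof -
  have pos: "a * z \<in> L1T \<and> TT (a * z) = a * TT z" if a: "a \<in> A" "0 \<le> a" and z: "z \<in> L1T" for a z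
  proof -
    obtain f g where z: "f \<in> domain_pos" "g \<in> domain_pos" "z = f - g" "TT z = tau f - tau g"
      using \<open>z \<in> L1T\<close> by (rule L1E)
    have "a * z = a * f - a * g" using z(3) by (simp add: right_diff_distrib)
    then show ?thesis
      using z tau_mult[OF a] by (simp add: L1_diffI extT_diff_eq right_diff_distrib)
  qed
  have "pprt a \<in> A" "- nprt a \<in> A"
    using rangeT_pprt[OF a] rangeT_pprt[of "- a"] a subspace_rangeT
    by (simp_all add: pprt_neg subspace_neg)
  then have *: "pprt a * z \<in> L1T \<and> TT (pprt a * z) = pprt a * TT z"
    "- nprt a * z \<in> L1T \<and> TT (- nprt a * z) = - nprt a * TT z"
    by (intro pos; simp add: z)+
  have eq: "a * w = pprt a * w - (- nprt a * w)" for w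
    by (subst prts[of a]) (simp add: distrib_right)
  show "a * z \<in> L1T" unfolding eq[of z] using * by (intro L1_diff) auto
  have "TT (a * z) = TT (pprt a * z) - TT (- nprt a * z)"
    unfolding eq[of z] using * by (intro extT_diff) auto
  also have "\<dots> = a * TT z" using * eq[of "TT z"] by simp
  finally show "TT (a * z) = a * TT z" .
qed

lemma rangeT_mult: "a \<in> A \<Longrightarrow> b \<in> A \<Longrightarrow> a * b \<in> A"
  using L1_mult[of a b] extT_mult[of a b] by (simp add: rangeT_iff)

section \<open>Multiplication operators on L2(T)\<close>

abbreviation H :: "'u set" where "H \<equiv> L2 E T"

lemma L2_iff: "x \<in> H \<longleftrightarrow> x \<in> L1T \<and> x * x \<in> L1T"
  by (simp add: L2_def)

lemma L2_solid:
  assumes "x \<in> H" "\<bar>y\<bar> \<le> \<bar>x\<bar>"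
  shows "y \<in> H"
proof -
  have "\<bar>y\<bar> * \<bar>y\<bar> \<le> \<bar>x\<bar> * \<bar>x\<bar>" using assms by (intro mult_mono) auto
  then have "\<bar>y * y\<bar> \<le> \<bar>x * x\<bar>" by (simp add: abs_mult_self square_nonneg)
  then show ?thesis using assms L1_solid by (auto simp: L2_iff)
qed

lemma L2_pprt: "x \<in> H \<Longrightarrow> pprt x \<in> H" and L2_nprt: "x \<in> H \<Longrightarrow> - nprt x \<in> H"
  by (rule L2_solid[of x]; simp add: abs_prts le_diff_eq)+

lemma L2_mult:
  assumes "x \<in> H" "y \<in> H"
  shows "x * y \<in> L1T"
proof (rule L1_solid)
  show "x * x + y * y \<in> L1T" using assms by (simp add: L2_iff L1_add)
  \<comment> \<open>Expanding this square bounds twice the product of the moduli by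
    \<open>x * x + y * y\<close>.\<close>
  have "0 \<le> (\<bar>x\<bar> - \<bar>y\<bar>) * (\<bar>x\<bar> - \<bar>y\<bar>)" by (rule square_nonneg)
  then have "\<bar>x\<bar> * \<bar>y\<bar> + \<bar>x\<bar> * \<bar>y\<bar> \<le> x * x + y * y"
    using f_algebra_mult_commute[of "\<bar>y\<bar>" "\<bar>x\<bar>"]
    by (simp add: left_diff_distrib right_diff_distrib abs_mult_self) (simp add: algebra_simps)
  moreover have "\<bar>x\<bar> * \<bar>y\<bar> \<le> \<bar>x\<bar> * \<bar>y\<bar> + \<bar>x\<bar> * \<bar>y\<bar>" by simp
  ultimately show "\<bar>x * y\<bar> \<le> \<bar>x * x + y * y\<bar>"
    using abs_ge_self[of "x * x + y * y"] unfolding abs_mult_eq by (blast intro: order_trans)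
qed

lemma L2_add: "x \<in> H \<Longrightarrow> y \<in> H \<Longrightarrow> x + y \<in> H"
  using L2_mult[of x y] L2_mult[of y x] by (simp add: L2_iff L1_add distrib_left distrib_right)

lemma L2_uminus: "x \<in> H \<Longrightarrow> - x \<in> H"
  by (simp add: L2_iff L1_uminus)

lemma L2_diff: "x \<in> H \<Longrightarrow> y \<in> H \<Longrightarrow> x - y \<in> H"
  using L2_add[of x "- y"] by (simp add: L2_uminus)

lemma mult_swap: "a * x * (b * y) = a * b * (x * y)" for x y :: 'u
  by (metis f_algebra_mult_commute mult.assoc)

lemma L2_module: "a \<in> A \<Longrightarrow> x \<in> H \<Longrightarrow> a * x \<in> H"
  by (simp add: L2_iff L1_mult mult_swap rangeT_mult)

lemma inner_T_module_left:
  assumes "a \<in> A" "x \<in> H" "y \<in> H"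
  shows "inner_T E T (a * x) y = a * inner_T E T x y"
  using assms by (simp add: inner_T_def mult.assoc extT_mult L2_mult)

lemma inner_T_commute: "inner_T E T x y = inner_T E T y x"
  by (simp add: inner_T_def f_algebra_mult_commute[of x y])

lemma inner_T_module_right:
  assumes "a \<in> A" "x \<in> H" "y \<in> H"
  shows "inner_T E T x (a * y) = a * inner_T E T x y"
  using inner_T_module_left[OF assms(1,3,2)] by (simp only: inner_T_commute[of x])

lemma inner_T_add_left:
  "x \<in> H \<Longrightarrow> y \<in> H \<Longrightarrow> z \<in> H \<Longrightarrow> inner_T E T (x + y) z = inner_T E T x z + inner_T E T y z"
  by (simp add: inner_T_def distrib_right extT_add L2_mult)

lemma inner_T_diff_right:
  "x \<in> H \<Longrightarrow> y \<in> H \<Longrightarrow> z \<in> H \<Longrightarrow> inner_T E T x (y - z) = inner_T E T x y - inner_T E T x z"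
  by (simp add: inner_T_def right_diff_distrib extT_diff L2_mult)

lemma inner_T_self_nonneg: "x \<in> H \<Longrightarrow> 0 \<le> inner_T E T x x"
  by (simp add: inner_T_def extT_nonneg L2_mult square_nonneg)

lemma inner_T_eq_0_imp:
  assumes "x \<in> H" "inner_T E T x x = 0"
  shows "x = 0"
  using assms extT_eq_0_imp[of "x * x"] square_eq_0_imp[of x]
  by (simp add: inner_T_def L2_mult square_nonneg)

lemma norm_T2_eqI:
  assumes "r \<in> A" "0 \<le> r" "r * r = TT (x * x)"
  shows "norm_T2 E T x = r"
  unfolding norm_T2_def using assms nonneg_square_eq_imp by (intro the_equality) auto

text \<open>The root must be found inside \<open>A\<close>; \<open>rangeT_lub\<close> and
  \<open>rangeT_mult\<close> keep the construction of \<open>square_root_exists\<close>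
  there.\<close>

lemma norm_T2:
  assumes "x \<in> H"
  shows "norm_T2 E T x \<in> A" "0 \<le> norm_T2 E T x" "norm_T2 E T x * norm_T2 E T x = TT (x * x)"
proof -
  have "TT (x * x) \<in> A" using assms by (simp add: rangeT_def L2_iff)
  moreover have "0 \<le> TT (x * x)" using inner_T_self_nonneg[OF assms] by (simp add: inner_T_def)
  ultimately have "\<exists>r\<in>A. 0 \<le> r \<and> r * r = TT (x * x)"
    by (intro square_root_exists[OF riesz_subspace_rangeT rangeT_lub rangeT_mult unit_in_rangeT])
  then show "norm_T2 E T x \<in> A" "0 \<le> norm_T2 E T x" "norm_T2 E T x * norm_T2 E T x = TT (x * x)"
    using norm_T2_eqI by auto
qed

text \<open>This equality exhibits the modulus of \<open>a\<close> as a strong bound for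
  multiplication by \<open>a\<close>.\<close>

lemma norm_T2_module:
  assumes "a \<in> A" "x \<in> H"
  shows "norm_T2 E T (a * x) = \<bar>a\<bar> * norm_T2 E T x"
proof (rule norm_T2_eqI)
  note n = norm_T2[OF assms(2)]
  show "\<bar>a\<bar> * norm_T2 E T x \<in> A" using n assms by (simp add: rangeT_mult rangeT_abs)
  show "0 \<le> \<bar>a\<bar> * norm_T2 E T x" using n by simp
  show "\<bar>a\<bar> * norm_T2 E T x * (\<bar>a\<bar> * norm_T2 E T x) = TT (a * x * (a * x))"
    using n assms by (simp add: mult_swap abs_mult_self extT_mult rangeT_mult L2_mult)
qed

section \<open>Boundedness, adjoints and positive square roots\<close>

lemma mult_op_bounded:
  assumes "a \<in> A"
  shows "mult_op H a \<in> bounded_ops E T"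
proof -
  have "b * x \<in> H" if "b \<in> A" "x \<in> H" for b x using that by (rule L2_module)
  moreover have "a * (b * x) = b * (a * x)" for b x by (metis f_algebra_mult_commute mult.assoc)
  ultimately show ?thesis
    using assms rangeT_abs[OF assms] norm_T2_module[OF assms]
    by (auto simp: bounded_ops_def mult_op_def L2_add distrib_left intro!: bexI[of _ "\<bar>a\<bar>"])
qed

lemma
  assumes "S \<in> bounded_ops E T"
  shows bounded_ops_in_L2: "x \<in> H \<Longrightarrow> S x \<in> H"
    and bounded_ops_module: "b \<in> A \<Longrightarrow> x \<in> H \<Longrightarrow> S (b * x) = b * S x"
    and bounded_ops_diff: "x \<in> H \<Longrightarrow> y \<in> H \<Longrightarrow> S (x - y) = S x - S y"
    and bounded_ops_eqI: "S' \<in> bounded_ops E T \<Longrightarrow> (\<And>x. x \<in> H \<Longrightarrow> S x = S' x) \<Longrightarrow> S = S'"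
proof -
  have S: "S \<in> H \<rightarrow>\<^sub>E H" "\<And>x y. x \<in> H \<Longrightarrow> y \<in> H \<Longrightarrow> S (x + y) = S x + S y"
    using assms by (auto simp: bounded_ops_def)
  show "x \<in> H \<Longrightarrow> S x \<in> H" using S(1) by auto
  show "b \<in> A \<Longrightarrow> x \<in> H \<Longrightarrow> S (b * x) = b * S x" using assms by (auto simp: bounded_ops_def)
  show "x \<in> H \<Longrightarrow> y \<in> H \<Longrightarrow> S (x - y) = S x - S y"
    using S(2)[of "x - y" y] by (simp add: L2_diff)
  show "S' \<in> bounded_ops E T \<Longrightarrow> (\<And>x. x \<in> H \<Longrightarrow> S x = S' x) \<Longrightarrow> S = S'"
    using S(1) by (intro PiE_ext[of S H "\<lambda>_. H" S']) (auto simp: bounded_ops_def)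
qed

lemma mult_op_self_adjoint:
  assumes "a \<in> A"
  shows "is_adjoint E T (mult_op H a) (mult_op H a)"
  unfolding is_adjoint_def
proof (intro conjI ballI)
  show "mult_op H a \<in> bounded_ops E T" using assms by (rule mult_op_bounded)
  show "inner_T E T (mult_op H a x) y = inner_T E T x (mult_op H a y)" if "x \<in> H" "y \<in> H" for x y
    using assms that by (simp add: mult_op_def inner_T_module_left inner_T_module_right)
qed

lemma adjoint_mult_op:
  assumes "a \<in> A"
  shows "adjoint_T E T (mult_op H a) = mult_op H a"
  unfolding adjoint_T_def
proof (rule the_equality)
  show "is_adjoint E T (mult_op H a) (mult_op H a)" using assms by (rule mult_op_self_adjoint)
  fix S assume S: "is_adjoint E T (mult_op H a) S"
  then have SB: "S \<in> bounded_ops E T" by (simp add: is_adjoint_def)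
  show "S = mult_op H a"
  proof (rule bounded_ops_eqI[OF SB mult_op_bounded[OF assms]])
    fix y assume y: "y \<in> H"
    \<comment> \<open>Testing the adjoint identity against this difference itself makes its inner
      square vanish.\<close>
    define w where "w = S y - a * y"
    have Sy: "S y \<in> H" and ay: "a * y \<in> H"
      using bounded_ops_in_L2[OF SB y] L2_module[OF assms y] .
    then have w: "w \<in> H" unfolding w_def by (rule L2_diff)
    have "inner_T E T (mult_op H a w) y = inner_T E T w (S y)"
      using S w y by (simp add: is_adjoint_def)
    then have "inner_T E T w (S y) = inner_T E T w (a * y)"
      using w y assms by (simp add: mult_op_def inner_T_module_left inner_T_module_right)
    then have "inner_T E T w w = 0"
      using inner_T_diff_right[OF w Sy ay] by (simp add: w_def)
    then have "w = 0" by (rule inner_T_eq_0_imp[OF w])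
    then show "S y = mult_op H a y" using y by (simp add: w_def mult_op_def)
  qed
qed

text \<open>With \<open>D = Q - M\<^bsub>|a|\<^esub>\<close>, the identity \<open>(Q + M\<^bsub>|a|\<^esub>) D = 0\<close> and positivity of both summands give
  \<open>\<bar>a\<bar> D = 0\<close>. Since \<open>Q\<close> vanishes wherever \<open>a\<close> does, also \<open>Q D = 0\<close>; hence \<open>D\<^sup>2 = 0\<close> and \<open>D = 0\<close>.\<close>

lemma positive_square_root_unique:
  assumes a: "a \<in> A" and Q: "self_adjoint E T Q" "inner_positive E T Q"
    and QQ: "\<And>x. x \<in> H \<Longrightarrow> Q (Q x) = a * (a * x)" and x: "x \<in> H"
  shows "Q x = \<bar>a\<bar> * x"
proof -
  define b where "b = \<bar>a\<bar>"
  have b: "b \<in> A" "0 \<le> b" using rangeT_abs[OF a] by (simp_all add: b_def)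
  have bb: "b * (b * x) = a * (a * x)" for x
    by (simp add: b_def abs_mult_self flip: mult.assoc)
  have QB: "Q \<in> bounded_ops E T"
    and sym: "\<And>x y. x \<in> H \<Longrightarrow> y \<in> H \<Longrightarrow> inner_T E T (Q x) y = inner_T E T x (Q y)"
    using Q(1) by (auto simp: self_adjoint_def is_adjoint_def)
  have QH: "Q x \<in> H" if "x \<in> H" for x using bounded_ops_in_L2[OF QB that] .
  have bH: "b * x \<in> H" if "x \<in> H" for x using L2_module[OF b(1) that] .
  have Q_diff: "Q (x - y) = Q x - Q y" if "x \<in> H" "y \<in> H" for x y
    using bounded_ops_diff[OF QB that] .
  have Q_b: "Q (b * x) = b * Q x" if "x \<in> H" for x using bounded_ops_module[OF QB b(1) that] .
  define d where "d x = Q x - b * x" for x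
  have dH: "d x \<in> H" if "x \<in> H" for x using that by (simp add: d_def L2_diff QH bH)
  have b_d: "b * d x = 0" if x: "x \<in> H" for x
  proof -
    \<comment> \<open>The cross terms cancel because the \<open>A\<close>-linear \<open>Q\<close>
      commutes with multiplication by \<open>b\<close>, leaving
      \<open>Q\<^sup>2 x - b\<^sup>2 x\<close>.\<close>
    have "Q (d x) + b * d x = 0"
      using x by (simp add: d_def Q_diff QH bH Q_b QQ right_diff_distrib bb)
    then have "inner_T E T (Q (d x)) (d x) + inner_T E T (b * d x) (d x) = 0"
      using inner_T_add_left[OF QH[OF dH[OF x]] bH[OF dH[OF x]] dH[OF x]]
      by (simp add: inner_T_def)
    moreover have "0 \<le> inner_T E T (Q (d x)) (d x)"
      using Q(2) dH[OF x] by (simp add: inner_positive_def)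
    moreover have "0 \<le> inner_T E T (b * d x) (d x)"
      using b dH[OF x] by (simp add: inner_T_module_left inner_T_self_nonneg)
    ultimately have "inner_T E T (b * d x) (d x) = 0" by (simp add: add_nonneg_eq_0_iff)
    \<comment> \<open>Strict positivity turns this into \<open>b (d x)\<^sup>2 = 0\<close>; one more
      factor \<open>b\<close> makes it the square of \<open>b * d x\<close>.\<close>
    then have "TT (b * (d x * d x)) = 0" by (simp add: inner_T_def mult.assoc)
    then have "b * (d x * d x) = 0"
      by (rule extT_eq_0_imp[rotated 2]) (use b dH[OF x] in \<open>auto simp: L1_mult L2_mult square_nonneg\<close>)
    then have "(b * d x) * (b * d x) = 0" by (simp add: mult_swap) (metis mult.assoc mult_zero_right)
    then show ?thesis by (rule square_eq_0_imp)
  qed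
  have Q_0: "Q y = 0" if y: "y \<in> H" "b * y = 0" for y
  proof -
    have "Q (Q y) = 0" using QQ[OF y(1)] bb[of y] y(2) by simp
    then have "inner_T E T (Q y) (Q y) = 0" using sym[OF y(1) QH[OF y(1)]] by (simp add: inner_T_def)
    then show ?thesis by (rule inner_T_eq_0_imp[OF QH[OF y(1)]])
  qed
  have "d (d x) = 0" using Q_0[OF dH[OF x] b_d[OF x]] b_d[OF x] by (simp add: d_def[of "d x"])
  \<comment> \<open>\<open>d\<close> is symmetric, being a difference of two symmetric maps.\<close>
  moreover have "inner_T E T (d x) (d x) = inner_T E T x (d (d x))"
  proof -
    have "inner_T E T (d x) (d x) = inner_T E T (d x) (Q x) - inner_T E T (d x) (b * x)"
      using inner_T_diff_right[OF dH[OF x] QH[OF x] bH[OF x]] by (simp add: d_def[of x])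
    also have "\<dots> = inner_T E T x (Q (d x)) - inner_T E T x (b * d x)"
      using sym[OF x dH[OF x]] inner_T_module_right[OF b(1) x dH[OF x]]
        inner_T_module_right[OF b(1) dH[OF x] x]
      by (simp add: inner_T_commute[of "d x"])
    also have "\<dots> = inner_T E T x (d (d x))"
      using inner_T_diff_right[OF x QH[OF dH[OF x]] bH[OF dH[OF x]]] by (simp add: d_def[of "d x"])
    finally show ?thesis .
  qed
  ultimately have "inner_T E T (d x) (d x) = 0" by (simp add: inner_T_def)
  then have "d x = 0" by (rule inner_T_eq_0_imp[OF dH[OF x]])
  then show ?thesis by (simp add: d_def b_def)
qed

section \<open>The two moduli of a multiplication operator\<close>

lemma spectral_modulus_mult_op:
  assumes a: "a \<in> A"
  shows "spectral_modulus E T (mult_op H a) = mult_op H \<bar>a\<bar>"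
  unfolding spectral_modulus_def adjoint_mult_op[OF a]
proof (rule the_equality, intro conjI)
  have b: "\<bar>a\<bar> \<in> A" using a by (rule rangeT_abs)
  show "mult_op H \<bar>a\<bar> \<in> bounded_ops E T" using b by (rule mult_op_bounded)
  show "self_adjoint E T (mult_op H \<bar>a\<bar>)"
    using b by (simp add: self_adjoint_def mult_op_self_adjoint mult_op_bounded)
  show "inner_positive E T (mult_op H \<bar>a\<bar>)"
    using b by (simp add: inner_positive_def mult_op_def inner_T_module_left inner_T_self_nonneg)
  have "\<bar>a\<bar> * (\<bar>a\<bar> * x) = a * (a * x)" for x by (simp add: abs_mult_self flip: mult.assoc)
  then show "compose H (mult_op H \<bar>a\<bar>) (mult_op H \<bar>a\<bar>) = compose H (mult_op H a) (mult_op H a)"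
    using a b by (auto simp: compose_def mult_op_def L2_module intro!: restrict_ext)
next
  fix Q assume "Q \<in> bounded_ops E T \<and> self_adjoint E T Q \<and> inner_positive E T Q \<and>
    compose H Q Q = compose H (mult_op H a) (mult_op H a)"
  then have Q: "Q \<in> bounded_ops E T" "self_adjoint E T Q" "inner_positive E T Q"
    and QQ: "compose H Q Q = compose H (mult_op H a) (mult_op H a)" by auto
  have "Q (Q x) = a * (a * x)" if "x \<in> H" for x
    using fun_cong[OF QQ, of x] that a by (simp add: compose_eq mult_op_def L2_module)
  then have "Q x = \<bar>a\<bar> * x" if "x \<in> H" for x
    using positive_square_root_unique[OF a Q(2,3) _ that] by blast
  then show "Q = mult_op H \<bar>a\<bar>"
    by (intro bounded_ops_eqI[OF Q(1) mult_op_bounded[OF rangeT_abs[OF a]]]) (simp add: mult_op_def)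
qed

lemma rk_modulus_mult_op:
  assumes a: "a \<in> A" and x: "x \<in> H" "0 \<le> x"
  shows "rk_modulus H (mult_op H a) x = \<bar>a\<bar> * x"
  unfolding rk_modulus_def
proof (rule the_equality)
  have "\<bar>a\<bar> * x \<in> H" using rangeT_abs[OF a] x(1) by (rule L2_module)
  moreover have "\<bar>a\<bar> * x \<in> {\<bar>mult_op H a u\<bar> | u. u \<in> H \<and> \<bar>u\<bar> \<le> x}"
    using x by (auto simp: mult_op_def abs_mult_eq intro!: exI[of _ x])
  moreover have "\<bar>mult_op H a u\<bar> \<le> \<bar>a\<bar> * x" if "u \<in> H" "\<bar>u\<bar> \<le> x" for u
    using that by (simp add: mult_op_def abs_mult_eq mult_left_mono)
  ultimately show lub: "isLub H {\<bar>mult_op H a u\<bar> | u. u \<in> H \<and> \<bar>u\<bar> \<le> x} (\<bar>a\<bar> * x)"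
    by (auto simp: isLub_def leastP_def isUb_def setle_def setge_def)
  show "s = \<bar>a\<bar> * x" if "isLub H {\<bar>mult_op H a u\<bar> | u. u \<in> H \<and> \<bar>u\<bar> \<le> x} s" for s
    using isLub_le_isUb[OF that isLub_isUb[OF lub]] isLub_le_isUb[OF lub isLub_isUb[OF that]]
    by (rule order.antisym)
qed

lemma order_modulus_mult_op:
  assumes a: "a \<in> A"
  shows "order_modulus H (mult_op H a) = mult_op H \<bar>a\<bar>"
proof -
  have "rk_modulus H (mult_op H a) (pprt x) - rk_modulus H (mult_op H a) (- nprt x) = \<bar>a\<bar> * x"
    if "x \<in> H" for x
  proof -
    have "rk_modulus H (mult_op H a) (pprt x) - rk_modulus H (mult_op H a) (- nprt x)
      = \<bar>a\<bar> * pprt x - \<bar>a\<bar> * (- nprt x)"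
      using rk_modulus_mult_op[OF a L2_pprt[OF that]] rk_modulus_mult_op[OF a L2_nprt[OF that]] by simp
    also have "\<dots> = \<bar>a\<bar> * (pprt x + nprt x)" by (simp add: distrib_left)
    finally show ?thesis by (simp only: prts[symmetric])
  qed
  then show ?thesis by (auto simp: order_modulus_def mult_op_def intro!: restrict_ext)
qed

end

theorem proposition11p1:
  fixes E :: "'u::universally_complete_f_algebra set" and e :: 'u and T :: "'u \<Rightarrow> 'u"
  assumes "universal_completion_of E"
    and "dedekind_complete_on E"
    and "weak_order_unit_on E e"
    and "\<And>x::'u. e * x = x" and "\<And>x::'u. x * e = x"
    and "conditional_expectation_on E T"
    and "T e = e"
    and "strictly_positive_on E T"
    and "a \<in> rangeT E T"
  shows "order_modulus (L2 E T) (mult_op (L2 E T) a) = spectral_modulus E T (mult_op (L2 E T) a)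
       \<and> spectral_modulus E T (mult_op (L2 E T) a) = mult_op (L2 E T) \<bar>a\<bar>"
proof -
  interpret extended_conditional_expectation e E T
    using assms by unfold_locales (simp_all add: weak_order_unit_on_def)
  show ?thesis
    using assms(9) by (simp add: spectral_modulus_mult_op order_modulus_mult_op)
qed

end
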